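(* Let $k\in\mathbb N$ and let $\beta=(\beta_{i,j})_{i,j\in\mathbb Z_+,\,i+j\le 2k}$ be a 2-dimensional real multisequence of degree $2k$. Suppose the moment matrix $M(k)$ is positive semidefinite and recursively generated. Let $$u^{(i)}:=(\beta_{0,i},\beta_{1,i},\beta_{2,i})\quad\text{for }i=0,\ldots,2k-2,$$ $$\widehat\beta:=(u^{(0)},\ldots,u^{(2k-2)}),\qquad \widetilde\beta:=(u^{(0)},\ldots,u^{(2k-2)},\beta_{0,2k-1},\beta_{1,2k-1})$$ (concatenated sequences). Then $\beta$ has a representing measure supported on the curve $y=x^3$ if and only if the following statements (1) and (2) hold: (1) If $k\ge3$, then $Y=X^3$ is a column relation of $M(k)$; if $k=2$, then the equalities $\beta_{0,1}=\beta_{3,0}$, $\beta_{1,1}=\beta_{4,0}$, $\beta_{0,2}=\beta_{3,1}$ hold (there is no condition if $k=1$). (2) One of the following holds: (a) $A_{\widetilde\beta}\succ0$. (b) $A_{\widetilde\beta}\succeq0$ and $\operatorname{rank}A_{\widehat\beta}=\operatorname{rank}A_{\widetilde\beta}=\operatorname{rank}M(k)$. Moreover, if a representing measure exists, then: if $A_{\widetilde\beta}$ is nonsingular, there exists a $(3k)$-atomic measure; if $A_{\widetilde\beta}$ is singular, then the measure is $(\operatorname{rank}M(k))$-atomic.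
   Context: $\mathbb N$ is the set of positive integers. For a sequence $\gamma=(\gamma_0,\ldots,\gamma_{2m})$ of odd length, $A_\gamma:=(\gamma_{i+j})_{i,j=0}^m$ is the corresponding Hankel matrix. $A\succ0$ ($\succeq0$) means positive (semi)definite. The moment matrix $M(k)$ of $\beta=(\beta_{i,j})_{i+j\le2k}$ has rows and columns indexed by the monomials $X^iY^j$, $i+j\le k$, and its entry in row $X^{i_1}Y^{j_1}$ and column $X^{i_2}Y^{j_2}$ is $\beta_{i_1+i_2,j_1+j_2}$. For a polynomial $p=\sum a_{ij}x^iy^j$ of degree at most $k$, $p(X,Y)$ denotes the corresponding linear combination $\sum a_{ij}X^iY^j$ of the columns of $M(k)$. "$Y=X^3$ is a column relation" means that the columns indexed by $Y$ and $X^3$ coincide. $M(k)$ is recursively generated if for all polynomials $p,q$ with $p,q,pq$ of degree at most $k$, $p(X,Y)=0$ implies $(pq)(X,Y)=0$. A representing measure for $\beta$ supported on a closed set $K\subseteq\mathbb R^2$ is a positive Borel measure $\mu$ with support in $K$ such that $\beta_{i,j}=\int_K x^iy^j\,d\mu$ for all $i+j\le 2k$. A measure is $m$-atomic if it is a sum of $m$ point masses with positive weights at distinct points. *)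

theory Defs
  imports
    "HOL-Analysis.Set_Integral"
    "HOL-Computational_Algebra.Polynomial"
    "Jordan_Normal_Form.DL_Rank"
begin

definition mat_rank :: "real mat \<Rightarrow> nat" where
  "mat_rank A = vec_space.rank (dim_row A) A"

definition pos_semidef :: "real mat \<Rightarrow> bool" where
  "pos_semidef A \<longleftrightarrow> square_mat A \<and> transpose_mat A = A \<and>
     (\<forall>v \<in> carrier_vec (dim_row A). 0 \<le> scalar_prod v (A *\<^sub>v v))"

definition pos_def :: "real mat \<Rightarrow> bool" where
  "pos_def A \<longleftrightarrow> square_mat A \<and> transpose_mat A = A \<and>
     (\<forall>v \<in> carrier_vec (dim_row A). v \<noteq> 0\<^sub>v (dim_row A) \<longrightarrow> 0 < scalar_prod v (A *\<^sub>v v))"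

text \<open>Only used for lists of odd length \<open>2 * m + 1\<close>, where the size is \<open>m + 1\<close>.\<close>

definition hankel_mat :: "real list \<Rightarrow> real mat" where
  "hankel_mat \<gamma> = (let n = Suc (length \<gamma> div 2) in mat n n (\<lambda>(i, j). \<gamma> ! (i + j)))"

text \<open>A multisequence of degree \<open>2 * k\<close> is a total function \<open>\<beta>\<close>; its values \<open>\<beta> i j\<close>
  with \<open>i + j > 2 * k\<close> are never inspected below.  The pair \<open>(i, j)\<close> stands for the monomial
  \<open>X ^ i * Y ^ j\<close>, and monomials are listed in degree-lexicographic order
  \<open>1, X, Y, X ^ 2, X Y, Y ^ 2, \<dots>\<close>.\<close>

definition monomials :: "nat \<Rightarrow> (nat \<times> nat) list" where
  "monomials k = concat (map (\<lambda>d. map (\<lambda>j. (d - j, j)) [0..<Suc d]) [0..<Suc k])"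

definition moment_column :: "(nat \<Rightarrow> nat \<Rightarrow> real) \<Rightarrow> nat \<Rightarrow> nat \<Rightarrow> nat \<Rightarrow> real vec" where
  "moment_column \<beta> k i j =
     vec (length (monomials k)) (\<lambda>r. case monomials k ! r of (i', j') \<Rightarrow> \<beta> (i' + i) (j' + j))"

definition moment_matrix :: "(nat \<Rightarrow> nat \<Rightarrow> real) \<Rightarrow> nat \<Rightarrow> real mat" where
  "moment_matrix \<beta> k =
     mat_of_cols (length (monomials k)) (map (\<lambda>(i, j). moment_column \<beta> k i j) (monomials k))"

text \<open>A bivariate polynomial is a polynomial in \<open>y\<close> whose coefficients are polynomials in \<open>x\<close>.\<close>

definition coeff2 :: "real poly poly \<Rightarrow> nat \<Rightarrow> nat \<Rightarrow> real" where
  "coeff2 p i j = poly.coeff (poly.coeff p j) i"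

definition total_degree_le :: "real poly poly \<Rightarrow> nat \<Rightarrow> bool" where
  "total_degree_le p k \<longleftrightarrow> (\<forall>i j. coeff2 p i j \<noteq> 0 \<longrightarrow> i + j \<le> k)"

text \<open>\<open>p(X, Y)\<close>, for \<open>p\<close> of total degree at most \<open>k\<close>: the linear combination of the columns
  of \<open>M(k)\<close> with the coefficients of \<open>p\<close>.\<close>

definition column_poly :: "(nat \<Rightarrow> nat \<Rightarrow> real) \<Rightarrow> nat \<Rightarrow> real poly poly \<Rightarrow> real vec" where
  "column_poly \<beta> k p =
     moment_matrix \<beta> k *\<^sub>v
       vec (length (monomials k)) (\<lambda>c. case monomials k ! c of (i, j) \<Rightarrow> coeff2 p i j)"

definition recursively_generated :: "(nat \<Rightarrow> nat \<Rightarrow> real) \<Rightarrow> nat \<Rightarrow> bool" where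
  "recursively_generated \<beta> k \<longleftrightarrow>
     (\<forall>p q. total_degree_le p k \<and> total_degree_le q k \<and> total_degree_le (p * q) k \<and>
        column_poly \<beta> k p = 0\<^sub>v (length (monomials k)) \<longrightarrow>
        column_poly \<beta> k (p * q) = 0\<^sub>v (length (monomials k)))"

definition measure_support :: "'a::topological_space measure \<Rightarrow> 'a set" where
  "measure_support \<mu> = {z. \<forall>U. open U \<and> z \<in> U \<longrightarrow> 0 < emeasure \<mu> U}"

definition representing_measure_on ::
    "(nat \<Rightarrow> nat \<Rightarrow> real) \<Rightarrow> nat \<Rightarrow> (real \<times> real) set \<Rightarrow> (real \<times> real) measure \<Rightarrow> bool" where
  "representing_measure_on \<beta> k K \<mu> \<longleftrightarrow>
     sets \<mu> = sets borel \<and> measure_support \<mu> \<subseteq> K \<and>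
     (\<forall>i j. i + j \<le> 2 * k \<longrightarrow>
        set_integrable \<mu> K (\<lambda>(x, y). x ^ i * y ^ j) \<and>
        \<beta> i j = set_lebesgue_integral \<mu> K (\<lambda>(x, y). x ^ i * y ^ j))"

definition atomic :: "nat \<Rightarrow> 'a::topological_space measure \<Rightarrow> bool" where
  "atomic m \<mu> \<longleftrightarrow>
     (\<exists>S w. finite S \<and> card S = m \<and> (\<forall>z\<in>S. 0 < (w z :: real)) \<and>
        sets \<mu> = sets borel \<and>
        (\<forall>B\<in>sets borel. emeasure \<mu> B = (\<Sum>z\<in>S. ennreal (w z) * indicator B z)))"

definition cubic_curve :: "(real \<times> real) set" where
  "cubic_curve = {(x, y). y = x ^ 3}"

definition u_block :: "(nat \<Rightarrow> nat \<Rightarrow> real) \<Rightarrow> nat \<Rightarrow> real list" where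
  "u_block \<beta> i = [\<beta> 0 i, \<beta> 1 i, \<beta> 2 i]"

text \<open>For \<open>k \<ge> 1\<close> the blocks run over \<open>i = 0, \<dots>, 2 * k - 2\<close>.\<close>

definition beta_hat :: "(nat \<Rightarrow> nat \<Rightarrow> real) \<Rightarrow> nat \<Rightarrow> real list" where
  "beta_hat \<beta> k = concat (map (u_block \<beta>) [0..<2 * k - 1])"

definition beta_tilde :: "(nat \<Rightarrow> nat \<Rightarrow> real) \<Rightarrow> nat \<Rightarrow> real list" where
  "beta_tilde \<beta> k = beta_hat \<beta> k @ [\<beta> 0 (2 * k - 1), \<beta> 1 (2 * k - 1)]"

end

theory Submission
  imports Defs "HOL-Computational_Algebra.Fundamental_Theorem_Algebra"
begin

text \<open>On the curve \<open>y = x ^ 3\<close> the monomial \<open>x ^ i * y ^ j\<close> equals \<open>x ^ (i + 3 * j)\<close>, so the problem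
  becomes a truncated Hamburger moment problem for a sequence \<open>g 0, \<dots>, g (6 * k)\<close> in which exactly
  \<open>g (6 * k - 1)\<close> is missing.  Let \<open>L\<close> be the linear functional \<open>x ^ d \<mapsto> g d\<close>.

  If the Hankel matrix of size \<open>3 * k\<close> is positive definite, the missing moment can be chosen so that
  some \<open>p\<close> of degree \<open>3 * k\<close> is \<open>L\<close>-orthogonal to all polynomials of degree at most \<open>3 * k\<close>:
  this is a quadratic equation, solvable because \<open>M(k)\<close> is positive semidefinite.  The zeros of \<open>p\<close> are
  real and simple and carry a Gauss quadrature for \<open>L\<close>.  In the flat singular case the
  kernel polynomial of least degree plays the role of \<open>p\<close>, and \<open>rank M(k)\<close> forces the last moment
  \<open>g (6 * k)\<close> to be the one of the quadrature.  Conversely, if a measure exists and the Hankel matrix is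
  singular, the measure lives on the zeros of a polynomial of degree less than \<open>3 * k\<close>, and
  all the ranks count its atoms.\<close>

unbundle no vec_syntax

section \<open>Column rank\<close>

text \<open>Why exactly one exponent is missing: \<open>6 * k - 1 = 2 + 3 * (2 * k - 1)\<close>
  belongs to X^2 Y^(2k-1), of degree 2k+1, and its other monomials have larger degree still. For the
  same reason x^(3k-1) comes from no monomial of degree at most k. Modulo the curve, M(k) is thus
  the Hankel matrix of size 3k+1 with row and column 3k-1 deleted. The Hankel matrix of
  \<open>beta_tilde\<close>, of size 3k, does contain that row but never reads g(6k); the two
  overlap in the Hankel matrix of \<open>beta_hat\<close>, of size 3k-1. Neither large matrix
  controls the other, which is why (b) compares three ranks. Flatness from \<open>beta_hat\<close>
  to \<open>beta_tilde\<close> yields a monic kernel polynomial of degree 3k-1, hence atoms that are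
  right up to g(6k-2). Flatness from \<open>beta_hat\<close> to M(k) expresses the column of x^(3k)
  by those of lower powers; this relation holds on the atoms as well and so fixes g(6k). In case
  (a), M(k) is tested on polynomials x^(3k) - c without x^(3k-1) term. Their squares have no term
  x^(6k-1), so the test is independent of the missing moment.\<close>

definition col_indep :: "'a::field mat \<Rightarrow> nat set \<Rightarrow> bool" where
  "col_indep A J \<longleftrightarrow>
     (\<forall>x. (\<forall>i<dim_row A. (\<Sum>j\<in>J. x j * A $$ (i, j)) = 0) \<longrightarrow> (\<forall>j\<in>J. x j = 0))"

definition in_col_span :: "'a::field mat \<Rightarrow> nat set \<Rightarrow> nat \<Rightarrow> bool" where
  "in_col_span A J c \<longleftrightarrow> (\<exists>x. \<forall>i<dim_row A. A $$ (i, c) = (\<Sum>j\<in>J. x j * A $$ (i, j)))"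

lemma col_indepD:
  assumes "col_indep A J" "\<And>i. i < dim_row A \<Longrightarrow> (\<Sum>j\<in>J. x j * A $$ (i, j)) = 0" "j \<in> J"
  shows "x j = 0"
  using assms unfolding col_indep_def by blast

lemma (in vec_space) lin_indpt_iff_sum:
  assumes "finite S" "S \<subseteq> carrier_vec n"
  shows "lin_indpt S \<longleftrightarrow>
    (\<forall>a. (\<forall>i<n. (\<Sum>v\<in>S. a v * v $ i) = 0) \<longrightarrow> (\<forall>v\<in>S. a v = 0))"
proof -
  have lc: "lincomb a S = 0\<^sub>v n \<longleftrightarrow> (\<forall>i<n. (\<Sum>v\<in>S. a v * v $ i) = 0)" for a
  proof
    assume "lincomb a S = 0\<^sub>v n"
    then show "\<forall>i<n. (\<Sum>v\<in>S. a v * v $ i) = 0"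
      using lincomb_index[OF _ assms(2), of _ a] by (metis index_zero_vec(1))
  next
    assume "\<forall>i<n. (\<Sum>v\<in>S. a v * v $ i) = 0"
    then show "lincomb a S = 0\<^sub>v n"
      using lincomb_index[OF _ assms(2), of _ a] lincomb_dim[OF assms(1,2), of a]
      by (intro eq_vecI) auto
  qed
  show ?thesis
  proof
    assume ind: "lin_indpt S"
    show "\<forall>a. (\<forall>i<n. (\<Sum>v\<in>S. a v * v $ i) = 0) \<longrightarrow> (\<forall>v\<in>S. a v = 0)"
    proof (intro allI impI ballI)
      fix a v assume a: "\<forall>i<n. (\<Sum>v\<in>S. a v * v $ i) = 0" and v: "v \<in> S"
      then have "lincomb a S = 0\<^sub>v n" using lc by blast
      then show "a v = 0"
        using ind v assms(1) unfolding lin_dep_def by auto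
    qed
  next
    assume *: "\<forall>a. (\<forall>i<n. (\<Sum>v\<in>S. a v * v $ i) = 0) \<longrightarrow> (\<forall>v\<in>S. a v = 0)"
    show "lin_indpt S"
    proof (rule finite_lin_indpt2[OF assms(1)])
      show "S \<subseteq> carrier_vec n" by (rule assms(2))
      fix a assume "lincomb a S = 0\<^sub>v n"
      then have "\<forall>i<n. (\<Sum>v\<in>S. a v * v $ i) = 0" unfolding lc .
      then show "\<forall>v\<in>S. a v = 0" by (rule *[THEN spec, THEN mp])
    qed
  qed
qed

text \<open>Independence of a set of vectors cannot see repeated columns, independence of an index
  set can; this is the source of \<open>inj_on (col A) J\<close>. Repetitions do occur: for k at
  least 3, condition (1) says that two columns of M(k) coincide.\<close>

lemma (in vec_space) col_indep_iff:
  assumes A: "A \<in> carrier_mat n nc" and J: "J \<subseteq> {..<nc}"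
  shows "col_indep A J \<longleftrightarrow> inj_on (col A) J \<and> lin_indpt (col A ` J)"
proof -
  have fin: "finite J" using J finite_subset by blast
  have sub: "col A ` J \<subseteq> carrier_vec n" using A by auto
  have colij: "col A j $ i = A $$ (i, j)" if "j \<in> J" "i < n" for i j
    using that A J by auto
  have sum_col: "(\<Sum>v\<in>col A ` J. a v * v $ i) = (\<Sum>j\<in>J. a (col A j) * A $$ (i, j))"
    if "inj_on (col A) J" "i < n" for a i
    using colij that(2) by (simp add: sum.reindex[OF that(1)])
  note ind = lin_indpt_iff_sum[OF finite_imageI[OF fin, of "col A"] sub]
  show ?thesis
  proof
    assume ci: "col_indep A J"
    have inj: "inj_on (col A) J"
    proof (rule inj_onI, rule ccontr)
      fix a b assume ab: "a \<in> J" "b \<in> J" "col A a = col A b" "a \<noteq> b"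
      define x where "x j = (if j = a then 1 else if j = b then - 1 else 0 :: 'a)" for j
      have "(\<Sum>j\<in>J. x j * A $$ (i, j)) = 0" if i: "i < dim_row A" for i
      proof -
        have "(\<Sum>j\<in>J. x j * A $$ (i, j)) = (\<Sum>j\<in>{a, b}. x j * A $$ (i, j))"
          using fin ab by (intro sum.mono_neutral_right) (auto simp: x_def)
        also have "\<dots> = A $$ (i, a) - A $$ (i, b)" using ab by (simp add: x_def)
        also have "\<dots> = 0" using colij[OF ab(1)] colij[OF ab(2)] ab(3) i A by simp
        finally show ?thesis .
      qed
      then have "x a = 0" by (rule col_indepD[OF ci _ ab(1)])
      then show False by (simp add: x_def)
    qed
    moreover have "lin_indpt (col A ` J)"
      unfolding ind
    proof (intro allI impI ballI)
      fix a v assume a: "\<forall>i<n. (\<Sum>v\<in>col A ` J. a v * v $ i) = 0" and v: "v \<in> col A ` J"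
      then obtain j where j: "j \<in> J" "v = col A j" by blast
      have "(\<Sum>j\<in>J. a (col A j) * A $$ (i, j)) = 0" if "i < dim_row A" for i
        using a sum_col[OF inj] that A by simp
      then have "a (col A j) = 0" by (rule col_indepD[OF ci _ j(1), of "\<lambda>j. a (col A j)"])
      then show "a v = 0" using j(2) by simp
    qed
    ultimately show "inj_on (col A) J \<and> lin_indpt (col A ` J)" by blast
  next
    assume asm: "inj_on (col A) J \<and> lin_indpt (col A ` J)"
    then have inj: "inj_on (col A) J" by blast
    show "col_indep A J"
      unfolding col_indep_def
    proof (intro allI impI)
      fix x assume x: "\<forall>i<dim_row A. (\<Sum>j\<in>J. x j * A $$ (i, j)) = 0"
      define a where "a v = x (inv_into J (col A) v)" for v
      have "\<forall>i<n. (\<Sum>v\<in>col A ` J. a v * v $ i) = 0"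
        using x A sum_col[OF inj, of _ a] inj by (simp add: a_def)
      then have "\<forall>v\<in>col A ` J. a v = 0" using asm ind by blast
      then show "\<forall>j\<in>J. x j = 0" using inj by (auto simp: a_def)
    qed
  qed
qed

lemma in_col_span_if_insert_dep:
  assumes ind: "col_indep A J" and dep: "\<not> col_indep A (insert c J)"
    and fin: "finite J" and c: "c \<notin> J"
  shows "in_col_span A J c"
proof -
  obtain x j0 where x: "\<And>i. i < dim_row A \<Longrightarrow> (\<Sum>j\<in>insert c J. x j * A $$ (i, j)) = 0"
    and j0: "j0 \<in> insert c J" "x j0 \<noteq> 0"
    using dep unfolding col_indep_def by blast
  have sum: "x c * A $$ (i, c) + (\<Sum>j\<in>J. x j * A $$ (i, j)) = 0" if "i < dim_row A" for i
    using x[OF that] fin c by simp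
  have xc: "x c \<noteq> 0"
  proof
    assume 0: "x c = 0"
    then have "(\<Sum>j\<in>J. x j * A $$ (i, j)) = 0" if "i < dim_row A" for i
      using sum[OF that] by simp
    then have "\<forall>j\<in>J. x j = 0" by (intro ballI) (rule col_indepD[OF ind, of x])
    then show False using j0 0 by blast
  qed
  have "A $$ (i, c) = (\<Sum>j\<in>J. (- x j / x c) * A $$ (i, j))" if "i < dim_row A" for i
  proof -
    have "(\<Sum>j\<in>J. (- x j / x c) * A $$ (i, j)) = - (\<Sum>j\<in>J. x j * A $$ (i, j)) / x c"
      by (simp add: sum_divide_distrib sum_negf)
    also have "- (\<Sum>j\<in>J. x j * A $$ (i, j)) = x c * A $$ (i, c)"
      by (rule minus_unique) (subst add.commute, rule sum[OF that])
    also have "\<dots> / x c = A $$ (i, c)" using xc by simp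
    finally show ?thesis by simp
  qed
  then show ?thesis
    unfolding in_col_span_def by (intro exI[of _ "\<lambda>j. - x j / x c"]) simp
qed

lemma not_in_col_span_if_insert_indep:
  assumes ind: "col_indep A (insert c J)" and fin: "finite J" and c: "c \<notin> J"
  shows "\<not> in_col_span A J c"
proof
  assume "in_col_span A J c"
  then obtain x where x: "\<And>i. i < dim_row A \<Longrightarrow> A $$ (i, c) = (\<Sum>j\<in>J. x j * A $$ (i, j))"
    unfolding in_col_span_def by blast
  let ?x = "\<lambda>j. if j = c then - 1 else x j"
  have "(\<Sum>j\<in>insert c J. ?x j * A $$ (i, j)) = 0" if "i < dim_row A" for i
  proof -
    have "(\<Sum>j\<in>J. ?x j * A $$ (i, j)) = (\<Sum>j\<in>J. x j * A $$ (i, j))"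
      using c by (intro sum.cong) auto
    then show ?thesis using fin c x[OF that] by simp
  qed
  then have "?x c = 0" by (rule col_indepD[OF ind, of ?x c]) simp_all
  then show False by simp
qed

text \<open>An independent spanning set of columns is maximal, since any further column would be
  both inside and outside its span. All ranks below are computed or compared through this
  criterion.\<close>

lemma mat_rank_eq_card:
  assumes J: "J \<subseteq> {..<dim_col A}" and ind: "col_indep A J"
    and span: "\<And>c. c < dim_col A \<Longrightarrow> c \<notin> J \<Longrightarrow> in_col_span A J c"
  shows "mat_rank A = card J"
proof -
  interpret vec_space "TYPE(real)" "dim_row A" .
  have A: "A \<in> carrier_mat (dim_row A) (dim_col A)" by simp
  have fin: "finite J" using J finite_subset by blast
  have inj: "inj_on (col A) J" and li: "lin_indpt (col A ` J)"
    using ind col_indep_iff[OF A J] by blast+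
  have colsA: "set (cols A) = col A ` {..<dim_col A}"
    by (auto simp: cols_def)
  have "maximal (col A ` J) (\<lambda>T. T \<subseteq> set (cols A) \<and> lin_indpt T)"
    unfolding maximal_def
  proof (intro conjI allI impI)
    show "col A ` J \<subseteq> set (cols A)" using J colsA by auto
    show "lin_indpt (col A ` J)" by (rule li)
    fix T assume asm: "col A ` J \<subseteq> T \<and> T \<subseteq> set (cols A) \<and> lin_indpt T"
    note T = asm[unfolded colsA, THEN conjunct1] asm[unfolded colsA, THEN conjunct2, THEN conjunct1]
      asm[THEN conjunct2, THEN conjunct2]
    show "T = col A ` J"
    proof (rule ccontr)
      assume "T \<noteq> col A ` J"
      then obtain c where c: "c < dim_col A" "col A c \<in> T" "col A c \<notin> col A ` J"
        using T(1,2) by fast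
      then have cJ: "c \<notin> J" by fast
      have sub: "insert (col A c) (col A ` J) \<subseteq> T" using T(1) c by simp
      have "lin_indpt (insert (col A c) (col A ` J))"
        using T(3) supset_ld_is_ld[OF _ sub] by (rule contrapos_nn)
      then have "col_indep A (insert c J)"
        using col_indep_iff[OF A, of "insert c J"] c J inj cJ by simp
      then show False using not_in_col_span_if_insert_indep[OF _ fin cJ] span[OF c(1) cJ] by blast
    qed
  qed
  from rank_card_indpt[OF A this] show ?thesis
    unfolding mat_rank_def using card_image[OF inj] by simp
qed

lemma col_indep_extend:
  assumes "J \<subseteq> {..<dim_col A}" "col_indep A J"
  shows "\<exists>J'. J \<subseteq> J' \<and> J' \<subseteq> {..<dim_col A} \<and> col_indep A J' \<and> mat_rank A = card J' \<and>
    (\<forall>c<dim_col A. c \<notin> J' \<longrightarrow> in_col_span A J' c)"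
proof -
  have "\<exists>J'. finite J' \<and> maximal J' (\<lambda>J. J \<subseteq> {..<dim_col A} \<and> col_indep A J) \<and> J \<subseteq> J'"
    by (rule maximal_exists_superset[of "{..<dim_col A}"]) (use assms in auto)
  then obtain J' where J': "finite J'" "maximal J' (\<lambda>J. J \<subseteq> {..<dim_col A} \<and> col_indep A J)" "J \<subseteq> J'"
    by blast
  have J'': "J' \<subseteq> {..<dim_col A}" "col_indep A J'"
    using J'(2) unfolding maximal_def by simp_all
  have max: "K = J'" if "J' \<subseteq> K" "K \<subseteq> {..<dim_col A}" "col_indep A K" for K
    using J'(2) that unfolding maximal_def by simp
  have span: "in_col_span A J' c" if c: "c < dim_col A" "c \<notin> J'" for c
  proof (rule in_col_span_if_insert_dep[OF J''(2) _ J'(1) c(2)])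
    show "\<not> col_indep A (insert c J')"
    proof
      assume "col_indep A (insert c J')"
      then have "insert c J' = J'" using max[OF subset_insertI] J''(1) c(1) by simp
      then show False using c(2) by blast
    qed
  qed
  show ?thesis
    by (intro exI[of _ J'] conjI J' J'' mat_rank_eq_card span allI impI)
qed

text \<open>A relation between columns of \<open>A\<close> restricts to the rows of
  \<open>B\<close>, so columns independent in \<open>B\<close> stay independent in \<open>A\<close>.
  If the ranks agree, a column basis of \<open>B\<close> is already one of \<open>A\<close>, over
  all rows of \<open>A\<close>. This turns flatness into linear relations between moments.\<close>

lemma submatrix_rank_eq_in_col_span:
  assumes row: "\<And>a. a < dim_row B \<Longrightarrow> \<rho> a < dim_row A"
    and col: "\<And>b. b < dim_col B \<Longrightarrow> \<kappa> b < dim_col A" and inj: "inj_on \<kappa> {..<dim_col B}"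
    and sub: "\<And>a b. a < dim_row B \<Longrightarrow> b < dim_col B \<Longrightarrow> B $$ (a, b) = A $$ (\<rho> a, \<kappa> b)"
    and rank: "mat_rank A = mat_rank B" and c: "c < dim_col A"
  obtains x where "\<And>i. i < dim_row A \<Longrightarrow> A $$ (i, c) = (\<Sum>b<dim_col B. x b * A $$ (i, \<kappa> b))"
proof -
  have "col_indep B {}" by (simp add: col_indep_def)
  then obtain J where J: "J \<subseteq> {..<dim_col B}" "col_indep B J" "mat_rank B = card J"
    using col_indep_extend[of "{}" B] by auto
  have fin: "finite J" using J finite_subset by blast
  have injJ: "inj_on \<kappa> J" using inj J(1) inj_on_subset by blast
  have sumJ: "(\<Sum>j\<in>\<kappa> ` J. x j * A $$ (i, j)) = (\<Sum>b\<in>J. x (\<kappa> b) * A $$ (i, \<kappa> b))" for x i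
    using injJ by (simp add: sum.reindex)
  have indA: "col_indep A (\<kappa> ` J)"
    unfolding col_indep_def
  proof (intro allI impI)
    fix x assume x: "\<forall>i<dim_row A. (\<Sum>j\<in>\<kappa> ` J. x j * A $$ (i, j)) = 0"
    have "(\<Sum>b\<in>J. x (\<kappa> b) * B $$ (a, b)) = 0" if a: "a < dim_row B" for a
    proof -
      have "(\<Sum>b\<in>J. x (\<kappa> b) * B $$ (a, b)) = (\<Sum>b\<in>J. x (\<kappa> b) * A $$ (\<rho> a, \<kappa> b))"
        using J(1) a sub by (intro sum.cong) auto
      then show ?thesis using x row[OF a] sumJ by simp
    qed
    then have "x (\<kappa> b) = 0" if "b \<in> J" for b
      by (rule col_indepD[OF J(2) _ that, of "\<lambda>b. x (\<kappa> b)"])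
    then show "\<forall>j\<in>\<kappa> ` J. x j = 0" by blast
  qed
  have subA: "\<kappa> ` J \<subseteq> {..<dim_col A}" using J(1) col by auto
  obtain J' where J': "\<kappa> ` J \<subseteq> J'" "J' \<subseteq> {..<dim_col A}" "mat_rank A = card J'"
    "\<And>c. c < dim_col A \<Longrightarrow> c \<notin> J' \<Longrightarrow> in_col_span A J' c"
    using col_indep_extend[OF subA indA] by blast
  have "card (\<kappa> ` J) = card J'" using J'(3) J(3) rank card_image[OF injJ] by simp
  then have J'_eq: "J' = \<kappa> ` J"
    using card_subset_eq[OF finite_subset[OF J'(2) finite_lessThan] J'(1)] by simp
  have "in_col_span A (\<kappa> ` J) c"
  proof (cases "c \<in> \<kappa> ` J")
    case True
    have "(\<Sum>j\<in>\<kappa> ` J. (if j = c then 1 else 0) * A $$ (i, j)) = A $$ (i, c)" for i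
      using True fin by (simp add: if_distrib[of "\<lambda>y. y * _"] sum.delta cong: if_cong)
    then show ?thesis
      unfolding in_col_span_def by (intro exI[of _ "\<lambda>j. if j = c then 1 else 0"]) simp
  next
    case False
    then show ?thesis using J'(4)[OF c] J'_eq by blast
  qed
  then obtain x where x: "\<And>i. i < dim_row A \<Longrightarrow> A $$ (i, c) = (\<Sum>j\<in>\<kappa> ` J. x j * A $$ (i, j))"
    unfolding in_col_span_def by blast
  have eq: "(\<Sum>b<dim_col B. (if b \<in> J then x (\<kappa> b) else 0) * A $$ (i, \<kappa> b))
      = (\<Sum>b\<in>J. x (\<kappa> b) * A $$ (i, \<kappa> b))" for i
    using J(1) by (intro sum.mono_neutral_cong_right) auto
  show thesis
  proof (rule that)
    show "A $$ (i, c) = (\<Sum>b<dim_col B. (if b \<in> J then x (\<kappa> b) else 0) * A $$ (i, \<kappa> b))"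
      if "i < dim_row A" for i
      by (rule trans[OF x[OF that] trans[OF sumJ eq[symmetric]]])
  qed
qed

section \<open>Quadrature for the functional of a moment sequence\<close>

definition momL :: "(nat \<Rightarrow> real) \<Rightarrow> real poly \<Rightarrow> real" where
  "momL g p = (\<Sum>i\<le>degree p. poly.coeff p i * g i)"

lemma momL_eq_sum: "degree p \<le> n \<Longrightarrow> momL g p = (\<Sum>i\<le>n. poly.coeff p i * g i)"
  unfolding momL_def by (intro sum.mono_neutral_left) (auto simp: coeff_eq_0)

lemma momL_add: "momL g (p + q) = momL g p + momL g q"
proof -
  define n where "n = max (degree p) (degree q)"
  have "degree p \<le> n" "degree q \<le> n" "degree (p + q) \<le> n"
    unfolding n_def by (simp_all add: degree_add_le_max)
  then show ?thesis
    by (simp add: momL_eq_sum[of _ n] sum.distrib algebra_simps)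
qed

lemma momL_smult: "momL g (smult c p) = c * momL g p"
  by (simp add: momL_eq_sum[OF degree_smult_le] momL_def sum_distrib_left mult.assoc)

lemma momL_0 [simp]: "momL g 0 = 0"
  by (simp add: momL_def)

lemma momL_diff: "momL g (p - q) = momL g p - momL g q"
  using momL_add[of g p "smult (- 1) q"] momL_smult[of g "- 1" q] by simp

lemma momL_uminus: "momL g (- p) = - momL g p"
  using momL_smult[of g "- 1" p] by simp

lemma momL_sum: "momL g (sum f A) = (\<Sum>a\<in>A. momL g (f a))"
  by (induction A rule: infinite_finite_induct) (auto simp: momL_add)

lemma momL_monom [simp]: "momL g (monom c n) = c * g n"
proof -
  have "momL g (monom c n) = (\<Sum>i\<le>n. poly.coeff (monom c n) i * g i)"
    by (rule momL_eq_sum) (rule degree_monom_le)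
  also have "\<dots> = (\<Sum>i\<le>n. if i = n then c * g i else 0)"
    by (intro sum.cong) auto
  also have "\<dots> = c * g n" by simp
  finally show ?thesis .
qed

lemma momL_cong: "(\<And>i. poly.coeff p i \<noteq> 0 \<Longrightarrow> g i = h i) \<Longrightarrow> momL g p = momL h p"
  unfolding momL_def by (intro sum.cong) auto

lemma momL_mult_right:
  assumes "degree q \<le> n"
  shows "momL g (p * q) = (\<Sum>j\<le>n. poly.coeff q j * momL g (p * monom 1 j))"
proof -
  have "q = (\<Sum>j\<le>n. smult (poly.coeff q j) (monom 1 j))"
    using poly_as_sum_of_monoms'[OF assms] by (simp add: smult_monom)
  then have "p * q = (\<Sum>j\<le>n. smult (poly.coeff q j) (p * monom 1 j))"
    by (metis (no_types, lifting) mult_smult_right sum.cong sum_distrib_left)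
  then show ?thesis by (simp add: momL_sum momL_smult)
qed

lemma momL_mult:
  assumes "degree p \<le> m" "degree q \<le> n"
  shows "momL g (p * q) = (\<Sum>i\<le>m. \<Sum>j\<le>n. poly.coeff p i * poly.coeff q j * g (i + j))"
proof -
  have "momL g (monom 1 j * p) = (\<Sum>i\<le>m. poly.coeff p i * g (i + j))" for j
    unfolding momL_mult_right[OF assms(1)] by (simp add: mult_monom add.commute)
  then have "momL g (p * q) = (\<Sum>j\<le>n. poly.coeff q j * (\<Sum>i\<le>m. poly.coeff p i * g (i + j)))"
    unfolding momL_mult_right[OF assms(2)] by (simp add: mult.commute)
  also have "\<dots> = (\<Sum>j\<le>n. \<Sum>i\<le>m. poly.coeff p i * poly.coeff q j * g (i + j))"
    by (simp add: sum_distrib_left mult_ac)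
  also have "\<dots> = (\<Sum>i\<le>m. \<Sum>j\<le>n. poly.coeff p i * poly.coeff q j * g (i + j))"
    by (rule sum.swap)
  finally show ?thesis .
qed

lemma momL_sq_add:
  "momL g ((p + q) * (p + q)) = momL g (p * p) + 2 * momL g (p * q) + momL g (q * q)"
proof -
  have "(p + q) * (p + q) = p * p + (p * q + p * q) + q * q" by (simp add: algebra_simps)
  then show ?thesis by (simp only: momL_add mult_2)
qed

section \<open>Real simple zeros and Gauss quadrature\<close>

lemma quadratic_dvd_of_complex_root:
  fixes p :: "real poly"
  assumes z: "poly (map_poly complex_of_real p) z = 0" and im: "Im z \<noteq> 0"
  shows "[:- Re z, 1:] ^ 2 + [:Im z ^ 2:] dvd p"
proof -
  define Q where "Q = [:- Re z, 1:] ^ 2 + [:Im z ^ 2:]"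
  define R where "R = p mod Q"
  have Q_eq: "Q = [:Re z ^ 2 + Im z ^ 2, - 2 * Re z, 1:]"
    by (simp add: Q_def power2_eq_square)
  have degR: "degree R < 2"
    unfolding R_def using degree_mod_less'[of Q p] by (cases "p mod Q = 0") (auto simp: Q_eq)
  have R_eq: "R = [:poly.coeff R 0, poly.coeff R 1:]"
  proof (rule poly_eqI)
    fix i show "poly.coeff R i = poly.coeff [:poly.coeff R 0, poly.coeff R 1:] i"
      using degR by (cases i; cases "i - 1") (auto simp: coeff_eq_0)
  qed
  let ?c = "map_poly complex_of_real"
  have add: "?c (p + q) = ?c p + ?c q" for p q
    by (intro poly_eqI) (simp add: coeff_map_poly)
  have mult: "?c (p * q) = ?c p * ?c q" for p q
    by (intro poly_eqI) (simp add: coeff_map_poly coeff_mult)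
  have "p = Q * (p div Q) + R" by (simp add: R_def)
  then have "?c p = ?c Q * ?c (p div Q) + ?c R"
    using add[of "Q * (p div Q)" R] mult[of Q "p div Q"] by simp
  moreover have "poly (?c Q) z = 0"
  proof -
    have "poly (?c Q) z = of_real (Re z ^ 2 + Im z ^ 2) + z * (of_real (- 2 * Re z) + z)"
      by (simp add: Q_eq map_poly_pCons)
    also have "\<dots> = 0" by (simp add: complex_eq_iff power2_eq_square algebra_simps)
    finally show ?thesis .
  qed
  ultimately have "poly (?c R) z = 0" using z by simp
  moreover have "poly (?c R) z = of_real (poly.coeff R 0) + z * of_real (poly.coeff R 1)"
    by (subst R_eq) (simp add: map_poly_pCons)
  ultimately have e: "of_real (poly.coeff R 0) + z * of_real (poly.coeff R 1) = 0" by simp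
  \<comment> \<open>The remainder modulo \<open>Q\<close> is real, of degree at most 1, and vanishes
    at \<open>z\<close>. As \<open>Im z\<close> is nonzero, the imaginary part kills the slope, and
    then the constant goes too.\<close>
  from arg_cong[OF e, of Im] im have r1: "poly.coeff R 1 = 0" by simp
  with e have "poly.coeff R 0 = 0" by simp
  with r1 R_eq have "R = 0" by simp
  then show ?thesis unfolding R_def Q_def by (simp add: dvd_eq_mod_eq_0)
qed

text \<open>The forbidden divisor (x - a)^2 + b^2 covers both defects at once: a pair of non-real
  zeros for \<open>b\<close> nonzero, a double real zero for \<open>b = 0\<close>.\<close>

lemma card_real_roots_eq_degree:
  fixes p :: "real poly"
  assumes "p \<noteq> 0" "\<And>a b. \<not> [:- a, 1:] ^ 2 + [:b ^ 2:] dvd p"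
  shows "card {x. poly p x = 0} = degree p"
  using assms
proof (induction "degree p" arbitrary: p)
  case 0
  then obtain c where "p = [:c:]" by (metis degree_eq_zeroE)
  with 0 show ?case by simp
next
  case (Suc n)
  have "\<not> constant (poly (map_poly complex_of_real p))"
    using Suc.hyps(2) by (simp add: constant_degree degree_map_poly)
  then obtain z where z: "poly (map_poly complex_of_real p) z = 0"
    using fundamental_theorem_of_algebra by blast
  have "Im z = 0" using quadratic_dvd_of_complex_root[OF z] Suc.prems(2) by blast
  then have "z = of_real (Re z)" by (simp add: complex_eq_iff)
  moreover have "poly (map_poly of_real p) (of_real x) = complex_of_real (poly p x)" for x
    by (induction p) (auto simp: map_poly_pCons)
  ultimately have "complex_of_real (poly p (Re z)) = 0" using z by metis
  then obtain q where q: "p = [:- Re z, 1:] * q"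
    by (auto simp: poly_eq_0_iff_dvd)
  have "q \<noteq> 0" using Suc.prems(1) q by auto
  then have "degree ([:- Re z, 1:] * q) = degree [:- Re z, 1:] + degree q"
    by (intro degree_mult_eq) simp_all
  then have dq: "degree p = Suc (degree q)" unfolding q by simp
  have "card {x. poly q x = 0} = degree q"
  proof (rule Suc.hyps(1))
    show "n = degree q" using dq Suc.hyps(2) by simp
    show "\<not> [:- a, 1:] ^ 2 + [:b ^ 2:] dvd q" for a b
      using Suc.prems(2)[of a b] q by (metis dvd_mult)
  qed fact
  moreover have "{x. poly p x = 0} = insert (Re z) {x. poly q x = 0}"
    by (auto simp: q)
  moreover have "poly q (Re z) \<noteq> 0"
  proof
    assume "poly q (Re z) = 0"
    then obtain q' where "q = [:- Re z, 1:] * q'" by (auto simp: poly_eq_0_iff_dvd)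
    moreover have "u * (u * q') = (u ^ 2 + [:0 ^ 2:]) * q'" for u
      by (simp add: power2_eq_square mult.assoc)
    ultimately have "p = ([:- Re z, 1:] ^ 2 + [:0 ^ 2:]) * q'" using q by metis
    then show False using Suc.prems(2) by (metis dvd_triv_left)
  qed
  ultimately show ?case
    using poly_roots_finite[OF \<open>q \<noteq> 0\<close>] dq by simp
qed

lemma momL_orthogonal:
  assumes "\<And>e. e \<le> n \<Longrightarrow> momL g (p * monom 1 e) = 0" "degree f \<le> n"
  shows "momL g (p * f) = 0"
  using assms(1) by (simp add: momL_mult_right[OF assms(2)])

lemma degree_eq_degree_div:
  fixes f p :: "'a::field poly"
  assumes "p \<noteq> 0" "f div p \<noteq> 0"
  shows "degree f = degree p + degree (f div p)"
proof -
  have "degree (p * (f div p)) = degree p + degree (f div p)"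
    using assms by (rule degree_mult_eq)
  moreover have "f = p * (f div p) + f mod p" by simp
  moreover have "f mod p = 0 \<or> degree (f mod p) < degree p"
    using degree_mod_less[OF assms(1)] by blast
  ultimately show ?thesis
    by (metis add.right_neutral degree_add_eq_left trans_less_add1)
qed

text \<open>The zeros of \<open>p\<close> are real and simple: if \<open>p = ((x - a) ^ 2 + b ^ 2) * h\<close>, then \<open>L (p * h)\<close>
  is both \<open>0\<close> and \<open>L (((x - a) * h) ^ 2) + b ^ 2 * L (h ^ 2) > 0\<close>.\<close>

lemma gauss_quadrature:
  assumes pd: "\<And>f. f \<noteq> 0 \<Longrightarrow> degree f < r \<Longrightarrow> 0 < momL g (f * f)"
    and p: "degree p = r" "p \<noteq> 0"
    and orth: "\<And>e. e + r \<le> N \<Longrightarrow> momL g (p * monom 1 e) = 0"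
    and N: "2 * r \<le> N"
  obtains S w where "finite S" "card S = r" "\<And>s. s \<in> S \<Longrightarrow> 0 < w s"
    "\<And>i. i \<le> N \<Longrightarrow> g i = (\<Sum>s\<in>S. w s * s ^ i)"
proof -
  have orth': "momL g (p * f) = 0" if "degree f + r \<le> N" for f
    by (rule momL_orthogonal[of "N - r"]) (use that N orth in auto)
  have "\<not> [:- a, 1:] ^ 2 + [:b ^ 2:] dvd p" for a b
  proof
    assume "[:- a, 1:] ^ 2 + [:b ^ 2:] dvd p"
    then obtain h where h: "p = ([:- a, 1:] ^ 2 + [:b ^ 2:]) * h" by blast
    define l where "l = [:- a, 1:] * h"
    have h0: "h \<noteq> 0" using h p by auto
    have "degree (([:- a, 1:] ^ 2 + [:b ^ 2:]) * h) = degree ([:- a, 1:] ^ 2 + [:b ^ 2:]) + degree h"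
      by (rule degree_mult_eq) (use h p h0 in auto)
    then have dh: "r = degree h + 2" using p(1) h by (simp add: power2_eq_square)
    have "degree l = degree [:- a, 1:] + degree h"
      unfolding l_def by (rule degree_mult_eq) (use h0 in auto)
    then have dl: "degree l = degree h + 1" by simp
    have l0: "l \<noteq> 0" using dl by auto
    have "(u ^ 2 + v) * h * h = (u * h) * (u * h) + v * (h * h)" for u v :: "real poly"
      by (simp add: algebra_simps power2_eq_square)
    then have "p * h = l * l + smult (b ^ 2) (h * h)"
      unfolding h l_def by simp
    then have "momL g (p * h) = momL g (l * l) + b ^ 2 * momL g (h * h)"
      by (simp add: momL_add momL_smult)
    moreover have "momL g (p * h) = 0" by (rule orth') (use dh N in simp)
    moreover have "0 < momL g (l * l)" by (rule pd) (use l0 dl dh in auto)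
    moreover have "0 < momL g (h * h)" by (rule pd) (use h0 dh in auto)
    ultimately show False
      by (metis add_pos_nonneg less_irrefl less_imp_le mult_nonneg_nonneg zero_le_power2)
  qed
  from card_real_roots_eq_degree[OF p(2) this]
  have card: "card {x. poly p x = 0} = r" using p(1) by simp
  define S where "S = {x. poly p x = 0}"
  have fin: "finite S" unfolding S_def by (rule poly_roots_finite[OF p(2)])
  \<comment> \<open>The Lagrange basis on the zeros. The weights \<open>momL g (lag s)\<close> are
    forced, since any quadrature on these nodes that is exact in degree below \<open>r\<close> has
    them.\<close>
  define lag where "lag s = smult (1 / (\<Prod>u\<in>S - {s}. s - u)) (\<Prod>u\<in>S - {s}. [:- u, 1:])" for s
  have lag: "poly (lag s) t = (if t = s then 1 else 0)" if "s \<in> S" "t \<in> S" for s t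
  proof -
    have "(\<Prod>u\<in>S - {s}. s - u) \<noteq> 0" using fin by auto
    moreover have "(\<Prod>u\<in>S - {s}. t - u) = 0" if "t \<noteq> s"
      using fin that \<open>t \<in> S\<close> by (intro prod_zero) auto
    ultimately show ?thesis by (simp add: lag_def poly_prod)
  qed
  have deglag: "degree (lag s) < r" if "s \<in> S" for s
  proof -
    have "degree (lag s) \<le> degree (\<Prod>u\<in>S - {s}. [:- u, 1:])" unfolding lag_def by simp
    also have "\<dots> \<le> card S - 1"
      using degree_prod_sum_le[of "S - {s}" "\<lambda>u. [:- u, 1:]"] fin that by (simp add: o_def)
    also have "\<dots> < r"
    proof -
      have "0 < card S" using fin that by (auto simp: card_gt_0_iff)
      then show ?thesis using card by (simp add: S_def)
    qed
    finally show ?thesis .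
  qed
  define w where "w s = momL g (lag s)" for s
  have quad: "momL g f = (\<Sum>s\<in>S. w s * poly f s)" if f: "degree f \<le> N" for f
  proof -
    \<comment> \<open>Orthogonality removes the quotient by \<open>p\<close>, so
      \<open>momL g f\<close> depends only on the values of \<open>f\<close> at the nodes. Exactness
      reaches as far as orthogonality does, which may be well beyond \<open>2 * r\<close>.\<close>
    have "momL g (p * (f div p)) = 0"
    proof (cases "f div p = 0")
      case False
      then have "degree f = degree p + degree (f div p)" by (rule degree_eq_degree_div[OF p(2)])
      then show ?thesis using f p by (intro orth') simp
    qed simp
    moreover have "f = p * (f div p) + f mod p" by simp
    ultimately have "momL g f = momL g (f mod p)" by (metis momL_add add_0)
    also have "f mod p = (\<Sum>s\<in>S. smult (poly f s) (lag s))"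
    \<comment> \<open>Without nodes no degree is below \<open>card S\<close>, so the comparison of
      values at the nodes needs \<open>r > 0\<close>.\<close>
    proof (cases "r = 0")
      case True
      then have "S = {}" using card fin by (simp add: S_def)
      moreover have "f mod p = 0" using True p degree_mod_less[OF p(2), of f] by simp
      ultimately show ?thesis by simp
    next
      case False
      show ?thesis
      proof (rule poly_eqI_degree[of S])
        show "poly (f mod p) t = poly (\<Sum>s\<in>S. smult (poly f s) (lag s)) t" if t: "t \<in> S" for t
        proof -
          have "poly f t = poly p t * poly (f div p) t + poly (f mod p) t"
            by (metis mult_div_mod_eq poly_add poly_mult)
          then have "poly (f mod p) t = poly f t" using t by (simp add: S_def)
          also have "\<dots> = (\<Sum>s\<in>S. if s = t then poly f s else 0)" using fin t by simp
          also have "\<dots> = (\<Sum>s\<in>S. poly f s * poly (lag s) t)"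
            using lag t by (intro sum.cong) auto
          finally show ?thesis by (simp add: poly_sum)
        qed
        show "degree (f mod p) < card S"
          using degree_mod_less[OF p(2), of f] p(1) False card by (auto simp: S_def)
        show "degree (\<Sum>s\<in>S. smult (poly f s) (lag s)) < card S"
          by (rule degree_sum_less)
              (use deglag card False in \<open>auto simp: S_def intro: le_less_trans[OF degree_smult_le]\<close>)
      qed
    qed
    finally show ?thesis by (simp add: momL_sum momL_smult w_def mult.commute)
  qed
  have wpos: "0 < w s" if s: "s \<in> S" for s
  proof -
    \<comment> \<open>At the nodes \<open>lag s\<close> agrees with its square, so the weight of
      \<open>s\<close> is the value of the functional at a square. That square has degree at most
      \<open>2 * r - 2\<close>, within the range of exactness.\<close>
    have "degree (lag s * lag s) \<le> N"
      using degree_mult_le[of "lag s" "lag s"] deglag[OF s] N by simp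
    then have "momL g (lag s * lag s) = (\<Sum>t\<in>S. w t * poly (lag s * lag s) t)" by (rule quad)
    also have "\<dots> = (\<Sum>t\<in>S. if t = s then w t else 0)"
      using lag s by (intro sum.cong) auto
    also have "\<dots> = w s" using fin s by simp
    finally have "momL g (lag s * lag s) = w s" .
    moreover have "lag s \<noteq> 0" using lag[OF s s] by auto
    ultimately show ?thesis using pd[of "lag s"] deglag[OF s] by simp
  qed
  show thesis
  proof (rule that[OF fin])
    show "card S = r" using card by (simp add: S_def)
    show "0 < w s" if "s \<in> S" for s by (rule wpos[OF that])
    show "g i = (\<Sum>s\<in>S. w s * s ^ i)" if "i \<le> N" for i
      using quad[of "monom 1 i"] that by (simp add: degree_monom_eq poly_monom)
  qed
qed

text \<open>The Cauchy-Schwarz argument for semidefinite forms: an isotropic vector lies in the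
  kernel.\<close>

lemma momL_null_kernel:
  assumes psd: "\<And>f. degree f \<le> n \<Longrightarrow> 0 \<le> momL g (f * f)"
    and p: "degree p \<le> n" "momL g (p * p) = 0" and f: "degree f \<le> n"
  shows "momL g (p * f) = 0"
proof (rule ccontr)
  assume nz: "momL g (p * f) \<noteq> 0"
  \<comment> \<open>With this \<open>t\<close> the square of \<open>f + smult t p\<close> would have
    the value -1.\<close>
  define t where "t = - (momL g (f * f) + 1) / (2 * momL g (p * f))"
  have "degree (f + smult t p) \<le> n"
    using p f by (intro degree_add_le) (auto intro: order_trans[OF degree_smult_le])
  from psd[OF this] have "0 \<le> momL g (f * f) + 2 * (t * momL g (p * f))"
    using p(2) by (simp add: momL_sq_add momL_smult mult.commute[of f p])
  also have "2 * (t * momL g (p * f)) = - (momL g (f * f) + 1)"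
    using nz by (simp add: t_def field_simps)
  finally show False by simp
qed

text \<open>The polynomial \<open>q\<close> encodes flatness: in the Hankel matrix of size n+1 the
  last column depends on the others. A null polynomial of least degree r is orthogonal to degree at
  most n by \<open>momL_null_kernel\<close>, but a quadrature exact up to degree 2n needs
  orthogonality up to degree 2n - r; \<open>q\<close> supplies the difference.\<close>

lemma quadrature_of_flat:
  assumes psd: "\<And>f. degree f \<le> n \<Longrightarrow> 0 \<le> momL g (f * f)"
    and q: "degree q = n" "poly.coeff q n = 1" "\<And>e. e \<le> n \<Longrightarrow> momL g (q * monom 1 e) = 0"
  obtains S w where "finite S" "card S \<le> n" "\<And>s. s \<in> S \<Longrightarrow> 0 < w s"
    "\<And>i. i \<le> 2 * n \<Longrightarrow> g i = (\<Sum>s\<in>S. w s * s ^ i)"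
proof -
  define P where "P r \<longleftrightarrow> (\<exists>p. degree p = r \<and> p \<noteq> 0 \<and> momL g (p * p) = 0)" for r
  define r where "r = (LEAST r. P r)"
  have q_orth: "momL g (q * f) = 0" if "degree f \<le> n" for f
    by (rule momL_orthogonal[of n]) (use q(3) that in auto)
  have "P n"
    unfolding P_def using q q_orth[of q] by (intro exI[of _ q]) auto
  then have "P r" and rn: "r \<le> n"
    unfolding r_def by (rule LeastI, rule Least_le)
  then obtain p where p: "degree p = r" "p \<noteq> 0" "momL g (p * p) = 0"
    unfolding P_def by blast
  have pd: "0 < momL g (f * f)" if "f \<noteq> 0" "degree f < r" for f
  proof -
    have "\<not> P (degree f)" using not_less_Least that(2) unfolding r_def by blast
    then have "momL g (f * f) \<noteq> 0" using that(1) unfolding P_def by blast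
    then show ?thesis using psd[of f] that(2) rn by simp
  qed
  have shift: "r + i \<le> n \<Longrightarrow> e \<le> n \<Longrightarrow> momL g (p * monom 1 (i + e)) = 0" for i e
  proof (induction i arbitrary: e)
    case 0
    then show ?case
      using momL_null_kernel[OF psd _ p(3), of n "monom 1 e"] p(1) rn by (simp add: degree_monom_eq)
  next
    case (Suc i)
    show ?case
    proof (cases "e = n")
      case False
      then show ?thesis using Suc.IH[of "Suc e"] Suc.prems by simp
    next
      case True
      \<comment> \<open>The new top power comes from \<open>q\<close>: the product of
        \<open>u\<close> and \<open>q\<close> has value 0 because \<open>u\<close> has degree at
        most n, and all terms of \<open>q\<close> below x^n contribute 0 by induction.\<close>
      define u where "u = p * monom 1 (Suc i)"
      have u: "momL g (u * monom 1 j) = momL g (p * monom 1 (i + Suc j))" for j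
        by (simp add: u_def mult.assoc mult_monom)
      have "degree u \<le> n"
        using degree_mult_le[of p "monom 1 (Suc i)"] p(1) Suc.prems by (simp add: u_def degree_monom_eq)
      from q_orth[OF this] have "0 = momL g (u * q)" by (simp add: mult.commute)
      also have "\<dots> = (\<Sum>j\<le>n. poly.coeff q j * momL g (u * monom 1 j))"
        by (rule momL_mult_right) (simp add: q)
      also have "\<dots> = (\<Sum>j\<le>n. if j = n then momL g (u * monom 1 n) else 0)"
      proof (intro sum.cong refl)
        fix j assume "j \<in> {..n}"
        then have "momL g (u * monom 1 j) = 0" if "j \<noteq> n"
          unfolding u using that Suc.prems by (intro Suc.IH) auto
        then show "poly.coeff q j * momL g (u * monom 1 j) = (if j = n then momL g (u * monom 1 n) else 0)"
          using q(2) by simp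
      qed
      also have "\<dots> = momL g (p * monom 1 (Suc i + n))" by (simp add: u)
      finally show ?thesis using True by simp
    qed
  qed
  have orth: "momL g (p * monom 1 e) = 0" if "e + r \<le> 2 * n" for e
  proof (cases "e \<le> n")
    case True
    then show ?thesis using shift[of 0 e] rn by simp
  next
    case False
    then show ?thesis using shift[of "e - n" n] that by simp
  qed
  obtain S w where "finite S" "card S = r" "\<And>s. s \<in> S \<Longrightarrow> 0 < w s"
    "\<And>i. i \<le> 2 * n \<Longrightarrow> g i = (\<Sum>s\<in>S. w s * s ^ i)"
    by (rule gauss_quadrature[OF pd p(1,2) orth, of "2 * n"]) (use rn in auto)
  then show thesis using that rn by blast
qed

text \<open>A definite form is nondegenerate, so it represents every functional \<open>b\<close> on
  degree below n. The induction is a Gram-Schmidt step. The degree bound on \<open>c\<close> is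
  stated by coefficients so that n = 0 leaves only \<open>c = 0\<close>.\<close>

lemma momL_riesz:
  assumes "\<And>f. f \<noteq> 0 \<Longrightarrow> degree f < n \<Longrightarrow> 0 < momL g (f * f)"
  shows "\<exists>c. (\<forall>i\<ge>n. poly.coeff c i = 0) \<and> (\<forall>e<n. momL g (c * monom 1 e) = b e)"
  using assms
proof (induction n arbitrary: b)
  case 0
  then show ?case by (intro exI[of _ 0]) simp
next
  case (Suc n)
  have pd: "\<And>f. f \<noteq> 0 \<Longrightarrow> degree f < n \<Longrightarrow> 0 < momL g (f * f)"
    using Suc.prems by simp
  obtain c where c: "\<forall>i\<ge>n. poly.coeff c i = 0" "\<forall>e<n. momL g (c * monom 1 e) = b e"
    using Suc.IH[OF pd] by blast
  obtain d where d: "\<forall>i\<ge>n. poly.coeff d i = 0" "\<forall>e<n. momL g (d * monom 1 e) = g (n + e)"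
    using Suc.IH[OF pd, of "\<lambda>e. g (n + e)"] by blast
  \<comment> \<open>The monic orthogonal polynomial of degree n: adding multiples of it changes the
    value against x^n and no earlier one.\<close>
  define u where "u = monom 1 n - d"
  have u0: "momL g (u * monom 1 e) = 0" if "e < n" for e
    using d(2) that by (simp add: u_def left_diff_distrib momL_diff mult_monom)
  have cu: "poly.coeff u n = 1" "\<And>i. i > n \<Longrightarrow> poly.coeff u i = 0"
    using d(1) by (simp_all add: u_def)
  have du: "degree u \<le> n" using cu(2) by (intro degree_le) simp
  have "momL g (u * u) = (\<Sum>j\<le>n. poly.coeff u j * momL g (u * monom 1 j))"
    by (rule momL_mult_right[OF du])
  also have "\<dots> = (\<Sum>j\<le>n. if j = n then momL g (u * monom 1 n) else 0)"
    using u0 cu(1) by (intro sum.cong) auto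
  also have "\<dots> = momL g (u * monom 1 n)" by simp
  finally have uu: "momL g (u * u) = momL g (u * monom 1 n)" .
  have "u \<noteq> 0" using cu(1) by auto
  then have nz: "momL g (u * monom 1 n) \<noteq> 0" using Suc.prems[of u] du uu by simp
  define \<alpha> where "\<alpha> = (b n - momL g (c * monom 1 n)) / momL g (u * monom 1 n)"
  have "momL g ((c + smult \<alpha> u) * monom 1 e) = b e" if "e < Suc n" for e
  proof (cases "e = n")
    case True
    then show ?thesis using nz by (simp add: distrib_right momL_add momL_smult \<alpha>_def)
  next
    case False
    then show ?thesis using that u0[of e] c(2) by (simp add: distrib_right momL_add momL_smult)
  qed
  moreover have "poly.coeff (c + smult \<alpha> u) i = 0" if "i \<ge> Suc n" for i
    using that c(1) cu(2) by simp
  ultimately show ?case by blast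
qed

text \<open>Only \<open>g (2 * n + 1)\<close> is free.  With \<open>q = x ^ (n + 1) - c\<close> orthogonal to degree below \<open>n\<close> and \<open>h\<close>
  representing the coefficient of \<open>x ^ n\<close>, the polynomial \<open>p = q - s * h\<close> is orthogonal to degree at most \<open>n\<close>
  for a suitable value of \<open>g (2 * n + 1)\<close> depending on \<open>s\<close>, and then \<open>L (p ^ 2) = L (q ^ 2) - s ^ 2 * L (h ^ 2)\<close>;
  \<open>s\<close> is chosen to make this vanish.\<close>

lemma quadrature_of_pos_def_gap:
  assumes pd: "\<And>f. f \<noteq> 0 \<Longrightarrow> degree f < Suc n \<Longrightarrow> 0 < momL g (f * f)"
    and gap: "\<And>c. (\<forall>i\<ge>n. poly.coeff c i = 0) \<Longrightarrow>
      0 \<le> momL g ((monom 1 (Suc n) - c) * (monom 1 (Suc n) - c))"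
  obtains S w where "finite S" "card S = Suc n" "\<And>s. s \<in> S \<Longrightarrow> 0 < w s"
    "\<And>i. i \<le> 2 * Suc n \<Longrightarrow> i \<noteq> 2 * n + 1 \<Longrightarrow> g i = (\<Sum>s\<in>S. w s * s ^ i)"
proof -
  obtain c where c: "\<forall>i\<ge>n. poly.coeff c i = 0"
    "\<forall>e<n. momL g (c * monom 1 e) = g (Suc n + e)"
    using momL_riesz[of n g "\<lambda>e. g (Suc n + e)"] pd by auto
  obtain h where h: "\<forall>i\<ge>Suc n. poly.coeff h i = 0"
    "\<forall>e<Suc n. momL g (h * monom 1 e) = (if e = n then 1 else 0)"
    using momL_riesz[of "Suc n" g "\<lambda>e. if e = n then 1 else 0"] pd by auto
  define q where "q = monom 1 (Suc n) - c"
  define a where "a = poly.coeff h n"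
  define D where "D = momL g (q * q)"
  define s where "s = sqrt (D / a)"
  \<comment> \<open>The new moment enters \<open>q * monom 1 n\<close> through its leading term
    alone; this value makes the functional equal to \<open>s\<close> there.\<close>
  define G where "G = g(2 * n + 1 := s + momL g (c * monom 1 n))"
  define p where "p = q - smult s h"
  have dc: "degree c \<le> n" by (rule degree_le) (use c(1) in auto)
  have dh: "degree h \<le> n" by (rule degree_le) (use h(1) in auto)
  have cq: "poly.coeff q n = 0" "poly.coeff q (Suc n) = 1" "\<And>i. i > Suc n \<Longrightarrow> poly.coeff q i = 0"
    using c(1) by (simp_all add: q_def)
  have G_eq: "momL G f = momL g f" if "poly.coeff f (2 * n + 1) = 0" for f
    by (rule momL_cong) (use that in \<open>auto simp: G_def\<close>)
  have G_eq': "momL G f = momL g f" if "degree f \<le> 2 * n" for f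
    by (rule G_eq) (use that in \<open>simp add: coeff_eq_0\<close>)
  have deg_mult: "degree (f * f') \<le> 2 * n" if "degree f \<le> n" "degree f' \<le> n" for f f' :: "real poly"
    using degree_mult_le[of f f'] that by simp
  have hG: "momL G (h * monom 1 e) = (if e = n then 1 else 0)" if "e \<le> n" for e
    using h(2) that G_eq'[OF deg_mult[OF dh]] by (simp add: degree_monom_eq)
  have hh: "momL G (h * h) = a"
  proof -
    have "momL G (h * h) = (\<Sum>j\<le>n. poly.coeff h j * momL G (h * monom 1 j))"
      by (rule momL_mult_right[OF dh])
    also have "\<dots> = (\<Sum>j\<le>n. if j = n then a else 0)"
      using hG by (intro sum.cong) (auto simp: a_def)
    finally show ?thesis by simp
  qed
  have "h \<noteq> 0" using h(2) by auto
  then have a: "a > 0" using pd[of h] dh hh G_eq'[OF deg_mult[OF dh dh]] by simp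
  have D: "D \<ge> 0" unfolding D_def q_def by (rule gap) (use c(1) in simp)
  have s: "s * s * a = D" unfolding s_def using a D by simp
  have qG: "momL G (q * monom 1 e) = (if e = n then s else 0)" if "e \<le> n" for e
  proof -
    have "momL G (c * monom 1 e) = momL g (c * monom 1 e)"
      by (rule G_eq'[OF deg_mult[OF dc]]) (use that in \<open>simp add: degree_monom_eq\<close>)
    then have "momL G (q * monom 1 e) = G (Suc n + e) - momL g (c * monom 1 e)"
      by (simp add: q_def left_diff_distrib momL_diff mult_monom)
    then show ?thesis using that c(2) by (auto simp: G_def)
  qed
  have pG: "momL G (p * monom 1 e) = 0" if "e \<le> n" for e
    using qG[OF that] hG[OF that] by (simp add: p_def left_diff_distrib momL_diff momL_smult)
  have pG': "momL G (p * f) = 0" if "degree f \<le> n" for f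
    by (rule momL_orthogonal[of n]) (use pG that in auto)
  \<comment> \<open>The coefficient of x^(2n+1) in the square is twice the product of the top two
    coefficients of \<open>q\<close>, and \<open>q\<close> has no x^n term. So \<open>D\<close> does
    not depend on the moment being chosen.\<close>
  have qq: "momL G (q * q) = D"
    unfolding D_def
  proof (rule G_eq)
    have "poly.coeff q i * poly.coeff q (2 * n + 1 - i) = 0" for i
    proof -
      consider "i < n" | "i = n" | "i = Suc n" | "i > Suc n" by linarith
      then show ?thesis
      proof cases
        case 1
        then show ?thesis using cq(3)[of "2 * n + 1 - i"] by simp
      qed (use cq in auto)
    qed
    then show "poly.coeff (q * q) (2 * n + 1) = 0"
      unfolding coeff_mult by (simp only: sum.neutral_const)
  qed
  have qh: "momL G (q * h) = a * s"
  proof -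
    have "momL G (q * h) = (\<Sum>j\<le>n. poly.coeff h j * momL G (q * monom 1 j))"
      by (rule momL_mult_right[OF dh])
    also have "\<dots> = (\<Sum>j\<le>n. if j = n then a * s else 0)"
      using qG by (intro sum.cong) (auto simp: a_def)
    finally show ?thesis by simp
  qed
  have "p = q + smult (- s) h" by (simp add: p_def)
  then have "momL G (p * p) = D - 2 * (s * (a * s)) + s * (s * a)"
    by (simp only: momL_sq_add) (simp add: momL_smult momL_uminus qq qh hh)
  also have "\<dots> = 0" using s by (simp add: algebra_simps)
  finally have pp: "momL G (p * p) = 0" .
  \<comment> \<open>Modulo degree at most n, where \<open>p\<close> is already orthogonal, x^(n+1)
    is \<open>p\<close> itself; the vanishing square gives the last orthogonality.\<close>
  have pG_Suc: "momL G (p * monom 1 (Suc n)) = 0"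
  proof -
    have "monom 1 (Suc n) = p + (c + smult s h)" by (simp add: p_def q_def)
    then have "momL G (p * monom 1 (Suc n)) = momL G (p * p) + momL G (p * (c + smult s h))"
      by (metis distrib_left momL_add)
    also have "momL G (p * (c + smult s h)) = 0"
      by (rule pG') (use dc dh in \<open>auto intro: degree_add_le order_trans[OF degree_smult_le]\<close>)
    finally show ?thesis using pp by simp
  qed
  have cp: "poly.coeff p (Suc n) = 1" "\<And>i. i > Suc n \<Longrightarrow> poly.coeff p i = 0"
    using cq h(1) by (simp_all add: p_def)
  have "degree p \<le> Suc n" by (rule degree_le) (use cp(2) in auto)
  moreover have "Suc n \<le> degree p" by (rule le_degree) (simp add: cp)
  ultimately have dp: "degree p = Suc n" by simp
  have p0: "p \<noteq> 0" using cp by auto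
  have pdG: "0 < momL G (f * f)" if "f \<noteq> 0" "degree f < Suc n" for f
    using pd[OF that] G_eq'[OF deg_mult[of f f]] that(2) by simp
  have orth: "momL G (p * monom 1 e) = 0" if "e + Suc n \<le> 2 * Suc n" for e
    using pG[of e] pG_Suc that by (cases "e = Suc n") auto
  show thesis
  proof (rule gauss_quadrature[OF pdG dp p0 orth, of "2 * Suc n"])
    fix S w
    assume S: "finite S" "card S = Suc n" "\<And>s. s \<in> S \<Longrightarrow> 0 < w s"
      "\<And>i. i \<le> 2 * Suc n \<Longrightarrow> G i = (\<Sum>s\<in>S. w s * s ^ i)"
    show thesis
    proof (rule that[OF S(1-3)])
      show "g i = (\<Sum>s\<in>S. w s * s ^ i)" if "i \<le> 2 * Suc n" "i \<noteq> 2 * n + 1" for i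
        using S(4)[OF that(1)] that(2) by (simp add: G_def)
    qed
  qed auto
qed

section \<open>Hankel and moment matrices\<close>

text \<open>Of all monomials equal to x^d on the curve, the one with X-exponent below 3 has least
  degree. For \<open>d \<le> 6 * k\<close> it lies within degree 2k, except at
  \<open>d = 6 * k - 1\<close>, where an arbitrary value \<open>\<beta> 2 (2 * k - 1)\<close> is
  read. The arguments below overwrite that value, multiply it by 0 or avoid it.\<close>

definition curve_moment :: "(nat \<Rightarrow> nat \<Rightarrow> real) \<Rightarrow> nat \<Rightarrow> real" where
  "curve_moment \<beta> d = \<beta> (d mod 3) (d div 3)"

definition hankel :: "nat \<Rightarrow> (nat \<Rightarrow> real) \<Rightarrow> real mat" where
  "hankel n g = mat n n (\<lambda>(i, j). g (i + j))"

lemma hankel_dims [simp]: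
  "hankel n g \<in> carrier_mat n n"
  "dim_row (hankel n g) = n" "dim_col (hankel n g) = n"
  by (simp_all add: hankel_def)

lemma hankel_nth [simp]: "i < n \<Longrightarrow> j < n \<Longrightarrow> hankel n g $$ (i, j) = g (i + j)"
  by (simp add: hankel_def)

lemma hankel_mat_map: "hankel_mat (map g [0..<2 * n + 1]) = hankel (Suc n) g"
  unfolding hankel_mat_def hankel_def Let_def
  by (intro eq_matI) (auto simp del: upt_Suc)

lemma concat_u_block: "concat (map (u_block \<beta>) [0..<n]) = map (curve_moment \<beta>) [0..<3 * n]"
proof (induction n)
  case (Suc n)
  have "[0..<3 * Suc n] = [0..<3 * n] @ [3 * n, 3 * n + 1, 3 * n + 2]"
    by (simp add: numeral_3_eq_3)
  moreover have "Suc (3 * n) mod 3 = 1" "Suc (3 * n) div 3 = n"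
    "Suc (Suc (3 * n)) mod 3 = 2" "Suc (Suc (3 * n)) div 3 = n"
    by presburger+
  ultimately show ?case using Suc
    by (simp add: u_block_def curve_moment_def)
qed simp

text \<open>The list has 6k-3 entries, the moments up to 6k-4. Its rows stand for 1, ..., x^(3k-2),
  the powers below the gap in M(k).\<close>

lemma hankel_mat_beta_hat:
  assumes "k \<ge> 1"
  shows "hankel_mat (beta_hat \<beta> k) = hankel (3 * k - 1) (curve_moment \<beta>)"
proof -
  obtain l where l: "k = Suc l" using assms by (cases k) auto
  have e: "3 * (2 * k - 1) = 2 * (3 * k - 2) + 1" by (simp add: l)
  have "beta_hat \<beta> k = map (curve_moment \<beta>) [0..<2 * (3 * k - 2) + 1]"
    unfolding beta_hat_def concat_u_block e ..
  then have "hankel_mat (beta_hat \<beta> k) = hankel (Suc (3 * k - 2)) (curve_moment \<beta>)"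
    by (simp only: hankel_mat_map)
  then show ?thesis by (simp add: l)
qed

text \<open>Two more moments, up to 6k-2, add the row of x^(3k-1), which no monomial indexing M(k)
  represents.\<close>

lemma hankel_mat_beta_tilde:
  assumes "k \<ge> 1"
  shows "hankel_mat (beta_tilde \<beta> k) = hankel (3 * k) (curve_moment \<beta>)"
proof -
  obtain l where l: "k = Suc l" using assms by (cases k) auto
  have e: "2 * (3 * k - 1) + 1 = Suc (Suc (3 * (2 * k - 1)))" by (simp add: l)
  have m: "Suc (3 * n) mod 3 = 1" "Suc (3 * n) div 3 = n" "3 * n mod 3 = 0" "3 * n div 3 = n" for n :: nat
    by presburger+
  have "beta_tilde \<beta> k = map (curve_moment \<beta>) [0..<2 * (3 * k - 1) + 1]"
    unfolding beta_tilde_def beta_hat_def concat_u_block e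
    using m[of "2 * k - 1"] by (simp only: upt_Suc) (simp add: curve_moment_def)
  then have "hankel_mat (beta_tilde \<beta> k) = hankel (Suc (3 * k - 1)) (curve_moment \<beta>)"
    by (simp only: hankel_mat_map)
  moreover have "Suc (3 * k - 1) = 3 * k" by (simp add: l)
  ultimately show ?thesis by simp
qed

section \<open>Hankel positivity as positivity on squares, and ranks of atomic moments\<close>

lemma hankel_quadratic_form:
  assumes "degree f \<le> n"
  defines "v \<equiv> vec (Suc n) (poly.coeff f)"
  shows "v \<bullet> (hankel (Suc n) g *\<^sub>v v) = momL g (f * f)"
proof -
  have "(hankel (Suc n) g *\<^sub>v v) $ i = (\<Sum>j<Suc n. g (i + j) * poly.coeff f j)"
    if "i < Suc n" for i
    using that by (auto simp: v_def scalar_prod_def atLeast0LessThan simp del: sum.lessThan_Suc intro!: sum.cong)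
  then have "v \<bullet> (hankel (Suc n) g *\<^sub>v v)
      = (\<Sum>i<Suc n. poly.coeff f i * (\<Sum>j<Suc n. g (i + j) * poly.coeff f j))"
    by (auto simp: v_def scalar_prod_def atLeast0LessThan simp del: sum.lessThan_Suc intro!: sum.cong)
  also have "\<dots> = momL g (f * f)"
    unfolding momL_mult[OF assms(1) assms(1)] lessThan_Suc_atMost
    by (simp add: sum_distrib_left mult_ac)
  finally show ?thesis .
qed

lemma vec_eq_vec_coeff:
  assumes "v \<in> carrier_vec (Suc n)"
  obtains f :: "real poly" where "degree f \<le> n" "v = vec (Suc n) (poly.coeff f)"
proof -
  define f :: "real poly" where "f = (\<Sum>i\<le>n. monom (v $ i) i)"
  have c: "poly.coeff f i = (if i \<le> n then v $ i else 0)" for i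
    by (auto simp: f_def coeff_sum if_distrib sum.delta cong: if_cong)
  show thesis
  proof (rule that)
    show "degree f \<le> n" by (rule degree_le) (simp add: c)
    show "v = vec (Suc n) (poly.coeff f)" using assms by (intro eq_vecI) (auto simp: c)
  qed
qed

lemma hankel_symmetric: "square_mat (hankel n g)" "transpose_mat (hankel n g) = hankel n g"
  by (auto simp: hankel_def add.commute intro!: eq_matI)

lemma pos_semidef_hankel_iff:
  "pos_semidef (hankel (Suc n) g) \<longleftrightarrow> (\<forall>f. degree f \<le> n \<longrightarrow> 0 \<le> momL g (f * f))"
proof
  assume *: "pos_semidef (hankel (Suc n) g)"
  show "\<forall>f. degree f \<le> n \<longrightarrow> 0 \<le> momL g (f * f)"
  proof (intro allI impI)
    fix f :: "real poly" assume f: "degree f \<le> n"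
    have "0 \<le> vec (Suc n) (poly.coeff f) \<bullet> (hankel (Suc n) g *\<^sub>v vec (Suc n) (poly.coeff f))"
      using * unfolding pos_semidef_def by simp
    then show "0 \<le> momL g (f * f)" by (simp add: hankel_quadratic_form[OF f])
  qed
next
  assume *: "\<forall>f. degree f \<le> n \<longrightarrow> 0 \<le> momL g (f * f)"
  have "0 \<le> v \<bullet> (hankel (Suc n) g *\<^sub>v v)" if "v \<in> carrier_vec (Suc n)" for v
    by (rule vec_eq_vec_coeff[OF that]) (use * hankel_quadratic_form in auto)
  then show "pos_semidef (hankel (Suc n) g)"
    unfolding pos_semidef_def using hankel_symmetric by simp
qed

lemma pos_def_hankel_iff:
  "pos_def (hankel (Suc n) g) \<longleftrightarrow> (\<forall>f. f \<noteq> 0 \<longrightarrow> degree f \<le> n \<longrightarrow> 0 < momL g (f * f))"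
proof
  assume *: "pos_def (hankel (Suc n) g)"
  show "\<forall>f. f \<noteq> 0 \<longrightarrow> degree f \<le> n \<longrightarrow> 0 < momL g (f * f)"
  proof (intro allI impI)
    fix f :: "real poly" assume f: "f \<noteq> 0" "degree f \<le> n"
    have "vec (Suc n) (poly.coeff f) $ degree f \<noteq> 0" using f by simp
    then have "vec (Suc n) (poly.coeff f) \<noteq> 0\<^sub>v (Suc n)"
      using f(2) by (metis index_zero_vec(1) less_Suc_eq_le)
    then have "0 < vec (Suc n) (poly.coeff f) \<bullet> (hankel (Suc n) g *\<^sub>v vec (Suc n) (poly.coeff f))"
      using * unfolding pos_def_def by simp
    then show "0 < momL g (f * f)" by (simp add: hankel_quadratic_form[OF f(2)])
  qed
next
  assume *: "\<forall>f. f \<noteq> 0 \<longrightarrow> degree f \<le> n \<longrightarrow> 0 < momL g (f * f)"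
  have "0 < v \<bullet> (hankel (Suc n) g *\<^sub>v v)" if v: "v \<in> carrier_vec (Suc n)" "v \<noteq> 0\<^sub>v (Suc n)" for v
  proof (rule vec_eq_vec_coeff[OF v(1)])
    fix f :: "real poly" assume f: "degree f \<le> n" "v = vec (Suc n) (poly.coeff f)"
    have "f \<noteq> 0" using f(2) v(2) by (auto simp: zero_vec_def)
    then show ?thesis using * f hankel_quadratic_form by simp
  qed
  then show "pos_def (hankel (Suc n) g)"
    unfolding pos_def_def using hankel_symmetric by simp
qed

text \<open>Such a matrix factors through evaluation at the atoms, as a Vandermonde matrix times
  weights times its transpose. The map \<open>e\<close> gives the exponent of an index and
  \<open>\<rho>\<close> finds the indices of exponents 0, ..., |S|-1; this treats Hankel and moment
  matrices alike.\<close>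

lemma mat_rank_atoms:
  assumes S: "finite S" "\<And>s. s \<in> S \<Longrightarrow> 0 < w s"
    and A: "\<And>i j. i < dim_row A \<Longrightarrow> j < dim_col A \<Longrightarrow>
      A $$ (i, j) = (\<Sum>s\<in>S. w s * s ^ (e i + e j))"
    and \<rho>: "\<And>b. b < card S \<Longrightarrow> \<rho> b < dim_row A \<and> \<rho> b < dim_col A \<and> e (\<rho> b) = b"
  shows "mat_rank A = card S"
proof -
  define r where "r = card S"
  have inj: "inj_on \<rho> {..<r}" by (rule inj_on_inverseI[of _ e]) (use \<rho> in \<open>auto simp: r_def\<close>)
  have subset: "\<rho> ` {..<r} \<subseteq> {..<dim_col A}" using \<rho> by (auto simp: r_def)
  have sumJ: "(\<Sum>j\<in>\<rho> ` {..<r}. x (e j) * A $$ (i, j)) = (\<Sum>s\<in>S. w s * s ^ e i * (\<Sum>b<r. x b * s ^ b))"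
    if i: "i < dim_row A" for x i
  proof -
    have "(\<Sum>j\<in>\<rho> ` {..<r}. x (e j) * A $$ (i, j)) = (\<Sum>b<r. x b * (\<Sum>s\<in>S. w s * s ^ (e i + b)))"
      unfolding sum.reindex[OF inj] comp_def using \<rho> i
      by (intro sum.cong refl) (simp add: A r_def)
    also have "\<dots> = (\<Sum>b<r. \<Sum>s\<in>S. w s * s ^ e i * (x b * s ^ b))"
      by (simp add: sum_distrib_left power_add mult_ac)
    also have "\<dots> = (\<Sum>s\<in>S. \<Sum>b<r. w s * s ^ e i * (x b * s ^ b))" by (rule sum.swap)
    finally show ?thesis by (simp add: sum_distrib_left)
  qed
  have "mat_rank A = card (\<rho> ` {..<r})"
  proof (rule mat_rank_eq_card[OF subset])
    show "col_indep A (\<rho> ` {..<r})"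
      unfolding col_indep_def
    proof (intro allI impI)
      fix x assume x: "\<forall>i<dim_row A. (\<Sum>j\<in>\<rho> ` {..<r}. x j * A $$ (i, j)) = 0"
      define y where "y b = x (\<rho> b)" for b
      define q where "q s = (\<Sum>b<r. y b * s ^ b)" for s :: real
      have xy: "(\<Sum>j\<in>\<rho> ` {..<r}. x j * A $$ (i, j)) = (\<Sum>j\<in>\<rho> ` {..<r}. y (e j) * A $$ (i, j))" for i
        using \<rho> by (intro sum.cong) (auto simp: y_def r_def)
      have "(\<Sum>s\<in>S. w s * s ^ a * q s) = 0" if "a < r" for a
        using sumJ[of "\<rho> a" y] x xy[of "\<rho> a"] \<rho>[of a] that by (simp add: q_def r_def)
      \<comment> \<open>Pairing the relation with its own coefficients produces a sum of weighted
        squares, so the polynomial \<open>q\<close> vanishes at every atom although its degree is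
        below their number.\<close>
      then have "(\<Sum>a<r. y a * (\<Sum>s\<in>S. w s * s ^ a * q s)) = 0" by simp
      also have "(\<Sum>a<r. y a * (\<Sum>s\<in>S. w s * s ^ a * q s)) = (\<Sum>a<r. \<Sum>s\<in>S. w s * q s * (y a * s ^ a))"
        by (simp add: sum_distrib_left mult_ac)
      also have "\<dots> = (\<Sum>s\<in>S. \<Sum>a<r. w s * q s * (y a * s ^ a))" by (rule sum.swap)
      also have "\<dots> = (\<Sum>s\<in>S. w s * (q s)\<^sup>2)"
        by (simp add: sum_distrib_left[symmetric] q_def[symmetric] power2_eq_square mult_ac)
      finally have "(\<Sum>s\<in>S. w s * (q s)\<^sup>2) = 0" .
      moreover have "0 \<le> w s * (q s)\<^sup>2" if "s \<in> S" for s
        using S(2)[OF that] by simp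
      ultimately have "\<forall>s\<in>S. w s * (q s)\<^sup>2 = 0"
        using sum_nonneg_eq_0_iff[OF S(1), of "\<lambda>s. w s * (q s)\<^sup>2"] by blast
      then have q0: "q s = 0" if "s \<in> S" for s
        using S(2)[OF that] that by fastforce
      define Q where "Q = (\<Sum>b<r. monom (y b) b)"
      have cQ: "poly.coeff Q b = (if b < r then y b else 0)" for b
        by (auto simp: Q_def coeff_sum if_distrib sum.delta cong: if_cong)
      have "y b = 0" if b: "b < r" for b
      proof -
        have "Q = 0"
        proof (rule poly_eqI_degree[of S])
          show "poly Q s = poly 0 s" if "s \<in> S" for s
            using q0[OF that] by (simp add: Q_def poly_sum poly_monom q_def)
          show "degree Q < card S"
            unfolding Q_def r_def[symmetric]
            by (rule degree_sum_less) (use b in \<open>auto intro: le_less_trans[OF degree_monom_le]\<close>)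
          show "degree (0 :: real poly) < card S" using b by (simp add: r_def)
        qed
        then show ?thesis using cQ[of b] b by simp
      qed
      then show "\<forall>j\<in>\<rho> ` {..<r}. x j = 0" by (auto simp: y_def)
    qed
    show "in_col_span A (\<rho> ` {..<r}) c" if c: "c < dim_col A" for c
    proof -
      define P where "P = (\<Prod>s\<in>S. [:- s, 1:])"
      \<comment> \<open>On the atoms x^(e c) agrees with its remainder modulo the polynomial
        vanishing there, and the remainder uses only exponents below |S|.\<close>
      define R where "R = monom 1 (e c) mod P"
      have P0: "P \<noteq> 0" using S(1) by (simp add: P_def)
      have "degree P \<le> r"
        using degree_prod_sum_le[OF S(1), of "\<lambda>s. [:- s, 1:]"] by (simp add: P_def r_def o_def)
      then have cR: "poly.coeff R b = 0" if "b \<ge> r" for b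
        using degree_mod_less[OF P0, of "monom 1 (e c)"] that by (auto simp: R_def coeff_eq_0)
      have R: "s ^ e c = (\<Sum>b<r. poly.coeff R b * s ^ b)" if s: "s \<in> S" for s
      proof -
        have "poly (monom 1 (e c)) s = poly (P * (monom 1 (e c) div P) + R) s" by (simp add: R_def)
        also have "\<dots> = poly R s" using S(1) s by (simp add: P_def poly_prod)
        also have "\<dots> = (\<Sum>b\<le>degree R. poly.coeff R b * s ^ b)" by (rule poly_altdef)
        also have "\<dots> = (\<Sum>b<r. poly.coeff R b * s ^ b)"
          using cR by (intro sum.mono_neutral_cong) (auto simp: coeff_eq_0 not_le not_less)
        finally show ?thesis by (simp add: poly_monom)
      qed
      have "A $$ (i, c) = (\<Sum>j\<in>\<rho> ` {..<r}. poly.coeff R (e j) * A $$ (i, j))" if i: "i < dim_row A" for i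
        unfolding sumJ[OF i] A[OF i c] using R by (intro sum.cong refl) (simp add: power_add mult_ac)
      then show ?thesis
        unfolding in_col_span_def by (intro exI[of _ "\<lambda>j. poly.coeff R (e j)"]) simp
    qed
  qed
  then show ?thesis using card_image[OF inj] by (simp add: r_def)
qed

section \<open>The monomials of M(k) as powers on the curve\<close>

lemma set_monomials: "set (monomials k) = {(i, j). i + j \<le> k}"
proof -
  have "set (monomials k) = (\<Union>d\<in>{..<Suc k}. (\<lambda>j. (d - j, j)) ` {..<Suc d})"
    unfolding monomials_def by (simp only: set_concat set_map set_upt image_image atLeast0LessThan)
  also have "\<dots> = {(i, j). i + j \<le> k}"
  proof (intro equalityI subsetI)
    fix x :: "nat \<times> nat" assume "x \<in> {(i, j). i + j \<le> k}"
    then obtain i j where x: "x = (i, j)" "i + j \<le> k" by blast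
    then have "x \<in> (\<lambda>j'. (i + j - j', j')) ` {..<Suc (i + j)}"
      by (intro image_eqI[of _ _ j]) simp_all
    then show "x \<in> (\<Union>d\<in>{..<Suc k}. (\<lambda>j. (d - j, j)) ` {..<Suc d})"
      using x(2) by (intro UN_I[of "i + j"]) simp_all
  next
    fix x :: "nat \<times> nat" assume "x \<in> (\<Union>d\<in>{..<Suc k}. (\<lambda>j. (d - j, j)) ` {..<Suc d})"
    then show "x \<in> {(i, j). i + j \<le> k}" by fastforce
  qed
  finally show ?thesis .
qed

lemma distinct_monomials: "distinct (monomials k)"
proof (induction k)
  case (Suc k)
  have "monomials (Suc k) = monomials k @ map (\<lambda>j. (Suc k - j, j)) [0..<Suc (Suc k)]"
  proof -
    have "concat (map F [0..<Suc (Suc k)]) = concat (map F [0..<Suc k]) @ F (Suc k)"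
      for F :: "nat \<Rightarrow> (nat \<times> nat) list"
      by simp
    then show ?thesis unfolding monomials_def .
  qed
  then show ?case using Suc set_monomials[of k]
    by (auto simp: distinct_map inj_on_def simp del: upt_Suc)
qed (simp add: monomials_def)

lemma sum_monomials:
  "(\<Sum>r<length (monomials k). F (monomials k ! r)) = (\<Sum>x\<in>{(i, j). i + j \<le> k}. F x)"
  using sum.reindex_bij_betw[OF bij_betw_nth[OF distinct_monomials refl refl], of F k]
  by (simp add: set_monomials)

lemma finite_triangle: "finite {(i, j). i + j \<le> (k :: nat)}"
  using finite_set[of "monomials k"] by (simp add: set_monomials)

definition moment_entry :: "(nat \<Rightarrow> nat \<Rightarrow> real) \<Rightarrow> nat \<times> nat \<Rightarrow> nat \<times> nat \<Rightarrow> real" where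
  "moment_entry \<beta> x y = \<beta> (fst x + fst y) (snd x + snd y)"

lemma moment_matrix_dims [simp]:
  "dim_row (moment_matrix \<beta> k) = length (monomials k)"
  "dim_col (moment_matrix \<beta> k) = length (monomials k)"
  by (simp_all add: moment_matrix_def)

lemma moment_matrix_nth:
  assumes "r < length (monomials k)" "c < length (monomials k)"
  shows "moment_matrix \<beta> k $$ (r, c) = moment_entry \<beta> (monomials k ! r) (monomials k ! c)"
  using assms
  by (simp add: moment_matrix_def mat_of_cols_index moment_column_def moment_entry_def split: prod.split)

lemma moment_matrix_mult_vec:
  assumes "r < length (monomials k)"
  shows "(moment_matrix \<beta> k *\<^sub>v vec (length (monomials k)) (\<lambda>c. u (monomials k ! c))) $ r
    = (\<Sum>y\<in>{(i, j). i + j \<le> k}. moment_entry \<beta> (monomials k ! r) y * u y)"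
  unfolding sum_monomials[symmetric]
  using assms by (auto simp: scalar_prod_def atLeast0LessThan moment_matrix_nth intro!: sum.cong)

lemma column_poly_nth:
  assumes "r < length (monomials k)"
  shows "column_poly \<beta> k p $ r
    = (\<Sum>y\<in>{(i, j). i + j \<le> k}. moment_entry \<beta> (monomials k ! r) y * coeff2 p (fst y) (snd y))"
  using moment_matrix_mult_vec[OF assms, of \<beta> "\<lambda>y. coeff2 p (fst y) (snd y)"]
  by (simp add: column_poly_def case_prod_beta)

lemma moment_matrix_quadratic_form:
  fixes u :: "nat \<times> nat \<Rightarrow> real" and k :: nat
  defines "v \<equiv> vec (length (monomials k)) (\<lambda>c. u (monomials k ! c))"
  shows "v \<bullet> (moment_matrix \<beta> k *\<^sub>v v)
    = (\<Sum>x\<in>{(i, j). i + j \<le> k}. u x * (\<Sum>y\<in>{(i, j). i + j \<le> k}. moment_entry \<beta> x y * u y))"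
proof -
  have "v \<bullet> (moment_matrix \<beta> k *\<^sub>v v)
    = (\<Sum>r<length (monomials k). v $ r * (moment_matrix \<beta> k *\<^sub>v v) $ r)"
    by (simp add: scalar_prod_def atLeast0LessThan)
  also have "\<dots> = (\<Sum>r<length (monomials k). u (monomials k ! r) *
      (\<Sum>y\<in>{(i, j). i + j \<le> k}. moment_entry \<beta> (monomials k ! r) y * u y))"
    unfolding v_def by (intro sum.cong refl) (simp only: moment_matrix_mult_vec lessThan_iff index_vec)
  also have "\<dots> = (\<Sum>x\<in>{(i, j). i + j \<le> k}. u x *
      (\<Sum>y\<in>{(i, j). i + j \<le> k}. moment_entry \<beta> x y * u y))"
    by (rule sum_monomials)
  finally show ?thesis .
qed

text \<open>The excluded exponent is 2 + 3(k-1), whose monomial X^2 Y^(k-1) has degree k+1. Used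
  with \<open>k\<close> for the rows of M(k) and with \<open>2 * k\<close> for the moments.\<close>

lemma mod_div_in_triangle:
  fixes d k :: nat
  assumes "d \<le> 3 * k" "d \<noteq> 3 * k - 1"
  shows "d mod 3 + d div 3 \<le> k"
proof -
  have *: "m + q \<le> k" if "3 * q + m \<le> 3 * k" "3 * q + m \<noteq> 3 * k - 1" "m < 3" for q m
  proof -
    have "q \<le> k" using that(1) by linarith
    moreover have "m = 0" if "q = k" using \<open>3 * q + m \<le> 3 * k\<close> that by linarith
    moreover have "m \<noteq> 2" if "Suc q = k" using \<open>3 * q + m \<noteq> 3 * k - 1\<close> that by auto
    moreover have "m \<le> 2" using that(3) by simp
    ultimately show ?thesis by linarith
  qed
  show ?thesis by (rule *) (use assms in simp_all)
qed

text \<open>The gap is real for every representation, not only for X-exponent below 3: Y-exponent k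
  gives 3k, k-1 gives at most 3k-2, and smaller ones stay below that. With \<open>k \<ge> 1\<close>
  the truncated difference \<open>3 * k - 1\<close> is the true one.\<close>

lemma triangle_exponent:
  fixes i j k :: nat
  assumes "k \<ge> 1" "i + j \<le> k"
  shows "i + 3 * j \<le> 3 * k" "i + 3 * j \<noteq> 3 * k - 1"
proof -
  consider "j = k" | "Suc j = k" | "Suc (Suc j) \<le> k" using assms(2) by linarith
  then show "i + 3 * j \<noteq> 3 * k - 1" using assms by cases linarith+
qed (use assms in simp)

text \<open>Total only by convention: no monomial \<open>X ^ i * Y ^ j\<close> with \<open>i + j \<le> k\<close> restricts to the power
  \<open>x ^ (3 * k - 1)\<close> on the curve.\<close>

definition mon_index :: "nat \<Rightarrow> nat \<Rightarrow> nat" where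
  "mon_index k d = (SOME r. r < length (monomials k) \<and> monomials k ! r = (d mod 3, d div 3))"

lemma mon_index:
  assumes "d \<le> 3 * k" "d \<noteq> 3 * k - 1"
  shows "mon_index k d < length (monomials k)" "monomials k ! mon_index k d = (d mod 3, d div 3)"
proof -
  have "(d mod 3, d div 3) \<in> set (monomials k)"
    using mod_div_in_triangle[OF assms] by (simp add: set_monomials)
  then have "\<exists>r. r < length (monomials k) \<and> monomials k ! r = (d mod 3, d div 3)"
    by (auto simp: in_set_conv_nth)
  from someI_ex[OF this]
  show "mon_index k d < length (monomials k)" "monomials k ! mon_index k d = (d mod 3, d div 3)"
    unfolding mon_index_def by blast+
qed

lemma mon_index_inj: "inj_on (mon_index k) {..<3 * k - 1}"
proof (rule inj_onI)
  fix a b assume ab: "a \<in> {..<3 * k - 1}" "b \<in> {..<3 * k - 1}" "mon_index k a = mon_index k b"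
  then have "(a mod 3, a div 3) = (b mod 3, b div 3)"
    using mon_index(2)[of a k] mon_index(2)[of b k] by simp
  then show "a = b" by (metis mod_mult_div_eq prod.inject)
qed

lemma moment_entry_curve:
  assumes cons: "\<And>i j. i + j \<le> 2 * k \<Longrightarrow> \<beta> i j = curve_moment \<beta> (i + 3 * j)"
    and x: "fst x + snd x \<le> k" and y: "fst y + snd y \<le> k"
  shows "moment_entry \<beta> x y = curve_moment \<beta> ((fst x + 3 * snd x) + (fst y + 3 * snd y))"
  unfolding moment_entry_def using cons[of "fst x + fst y" "snd x + snd y"] x y
  by (simp add: algebra_simps)

text \<open>Inside M(k) this exhibits the Hankel matrix of size 3k+1 without row and column
  3k-1.\<close>

lemma moment_matrix_mon_index:
  assumes cons: "\<And>i j. i + j \<le> 2 * k \<Longrightarrow> \<beta> i j = curve_moment \<beta> (i + 3 * j)"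
    and "d \<le> 3 * k" "d \<noteq> 3 * k - 1" "e \<le> 3 * k" "e \<noteq> 3 * k - 1"
  shows "moment_matrix \<beta> k $$ (mon_index k d, mon_index k e) = curve_moment \<beta> (d + e)"
  using moment_entry_curve[OF cons, where x = "(d mod 3, d div 3)" and y = "(e mod 3, e div 3)"] assms(2-)
  by (simp add: moment_matrix_nth mon_index mod_div_in_triangle)

text \<open>A polynomial of degree at most 3k without x^(3k-1) term lifts from the curve to a
  bivariate polynomial of degree at most k, and M(k) is nonnegative on the lift.\<close>

lemma moment_matrix_gap_nonneg:
  assumes cons: "\<And>i j. i + j \<le> 2 * k \<Longrightarrow> \<beta> i j = curve_moment \<beta> (i + 3 * j)"
    and psd: "pos_semidef (moment_matrix \<beta> k)"
    and f: "degree f \<le> 3 * k" "poly.coeff f (3 * k - 1) = 0" and k: "k \<ge> 1"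
  shows "0 \<le> momL (curve_moment \<beta>) (f * f)"
proof -
  define T where "T = {(i, j). i + j \<le> k}"
  \<comment> \<open>The coefficients of the lift with X-exponents below 3, so that each power of x
    is used once.\<close>
  define u where "u x = (if fst x < 3 then poly.coeff f (fst x + 3 * snd x) else 0)" for x
  have sum_u: "(\<Sum>x\<in>T. u x * H x) = (\<Sum>d\<le>3 * k. poly.coeff f d * H (d mod 3, d div 3))" for H
  proof -
    have "(\<Sum>x\<in>T. u x * H x) = (\<Sum>x\<in>{x \<in> T. fst x < 3}. poly.coeff f (fst x + 3 * snd x) * H x)"
      unfolding u_def T_def using finite_triangle
      by (intro sum.mono_neutral_cong_right) auto
    also have "\<dots> = (\<Sum>d\<in>{d. d \<le> 3 * k \<and> d \<noteq> 3 * k - 1}. poly.coeff f d * H (d mod 3, d div 3))"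
    proof (rule sum.reindex_bij_witness[of _ "\<lambda>d. (d mod 3, d div 3)" "\<lambda>x. fst x + 3 * snd x"])
      fix x assume x: "x \<in> {x \<in> T. fst x < 3}"
      then show "((fst x + 3 * snd x) mod 3, (fst x + 3 * snd x) div 3) = x" by auto
      then show "poly.coeff f (fst x + 3 * snd x) *
          H ((fst x + 3 * snd x) mod 3, (fst x + 3 * snd x) div 3) =
          poly.coeff f (fst x + 3 * snd x) * H x" by simp
      show "fst x + 3 * snd x \<in> {d. d \<le> 3 * k \<and> d \<noteq> 3 * k - 1}"
        using x triangle_exponent[OF k] by (auto simp: T_def)
    qed (auto simp: T_def mod_div_in_triangle)
    also have "\<dots> = (\<Sum>d\<le>3 * k. poly.coeff f d * H (d mod 3, d div 3))"
      using f(2) by (intro sum.mono_neutral_left) auto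
    finally show ?thesis .
  qed
  define v where "v = vec (length (monomials k)) (\<lambda>c. u (monomials k ! c))"
  have "0 \<le> v \<bullet> (moment_matrix \<beta> k *\<^sub>v v)"
    using psd unfolding pos_semidef_def v_def by simp
  also have "\<dots> = (\<Sum>x\<in>T. u x * (\<Sum>y\<in>T. u y * moment_entry \<beta> x y))"
    unfolding v_def T_def moment_matrix_quadratic_form by (simp add: mult.commute)
  also have "\<dots> = (\<Sum>d\<le>3 * k. poly.coeff f d * (\<Sum>e\<le>3 * k. poly.coeff f e *
      moment_entry \<beta> (d mod 3, d div 3) (e mod 3, e div 3)))"
    unfolding sum_u ..
  also have "\<dots> = (\<Sum>d\<le>3 * k. poly.coeff f d * (\<Sum>e\<le>3 * k. poly.coeff f e * curve_moment \<beta> (d + e)))"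
  proof (intro sum.cong refl)
    fix d assume d: "d \<in> {..3 * k}"
    show "poly.coeff f d * (\<Sum>e\<le>3 * k. poly.coeff f e *
        moment_entry \<beta> (d mod 3, d div 3) (e mod 3, e div 3)) =
      poly.coeff f d * (\<Sum>e\<le>3 * k. poly.coeff f e * curve_moment \<beta> (d + e))"
    \<comment> \<open>Row and column 3k-1 would read moments outside degree 2k; there the
      coefficient of \<open>f\<close> is 0.\<close>
    proof (cases "d = 3 * k - 1")
      case False
      have "poly.coeff f e * moment_entry \<beta> (d mod 3, d div 3) (e mod 3, e div 3) =
        poly.coeff f e * curve_moment \<beta> (d + e)" if "e \<in> {..3 * k}" for e
        using moment_entry_curve[OF cons, where x = "(d mod 3, d div 3)" and y = "(e mod 3, e div 3)"] that d f(2) False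
        by (cases "e = 3 * k - 1") (simp_all add: mod_div_in_triangle)
      then show ?thesis by (metis (no_types, lifting) sum.cong)
    next
      case True
      then show ?thesis using f(2) by simp
    qed
  qed
  also have "\<dots> = momL (curve_moment \<beta>) (f * f)"
    unfolding momL_mult[OF f(1) f(1)] by (simp add: sum_distrib_left mult_ac)
  finally show ?thesis .
qed

text \<open>The bound on \<open>card S\<close> keeps the consecutive exponents 0, ..., |S|-1 below
  the gap, so that M(k) has a column for each of them.\<close>

lemma mat_rank_moment_matrix_atoms:
  assumes S: "finite S" "\<And>s. s \<in> S \<Longrightarrow> 0 < w s" "card S \<le> 3 * k - 1"
    and \<beta>: "\<And>i j. i + j \<le> 2 * k \<Longrightarrow> \<beta> i j = (\<Sum>s\<in>S. w s * s ^ (i + 3 * j))"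
  shows "mat_rank (moment_matrix \<beta> k) = card S"
proof (rule mat_rank_atoms[OF S(1,2), where e = "\<lambda>r. fst (monomials k ! r) + 3 * snd (monomials k ! r)"
      and \<rho> = "mon_index k"])
  have in_triangle: "fst (monomials k ! r) + snd (monomials k ! r) \<le> k" if "r < length (monomials k)" for r
    using nth_mem[OF that] unfolding set_monomials by auto
  fix i j assume ij: "i < dim_row (moment_matrix \<beta> k)" "j < dim_col (moment_matrix \<beta> k)"
  then show "moment_matrix \<beta> k $$ (i, j) = (\<Sum>s\<in>S. w s *
      s ^ (fst (monomials k ! i) + 3 * snd (monomials k ! i) + (fst (monomials k ! j) + 3 * snd (monomials k ! j))))"
    using in_triangle[of i] in_triangle[of j]
    by (simp add: moment_matrix_nth moment_entry_def \<beta> algebra_simps)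
qed (use S(3) mon_index in simp_all)

lemma mat_rank_hankel_atoms:
  assumes S: "finite S" "\<And>s. s \<in> S \<Longrightarrow> 0 < w s" "card S \<le> n"
    and g: "\<And>i. i + 2 \<le> 2 * n \<Longrightarrow> g i = (\<Sum>s\<in>S. w s * s ^ i)"
  shows "mat_rank (hankel n g) = card S"
  by (rule mat_rank_atoms[OF S(1,2), where e = id and \<rho> = id]) (use S(3) g in auto)

text \<open>The Hankel matrix of size 3k-1 sits in M(k) on the powers below the gap, so equal ranks
  express the column of Y^k, that is x^(3k), by them. Row \<open>e = 3 * k\<close> of this relation
  is the one that reaches g(6k).\<close>

lemma moment_matrix_flat_relation:
  assumes cons: "\<And>i j. i + j \<le> 2 * k \<Longrightarrow> \<beta> i j = curve_moment \<beta> (i + 3 * j)"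
    and rank: "mat_rank (moment_matrix \<beta> k) = mat_rank (hankel (3 * k - 1) (curve_moment \<beta>))"
    and k: "k \<ge> 1"
  obtains x where "\<And>e. e \<le> 3 * k \<Longrightarrow> e \<noteq> 3 * k - 1 \<Longrightarrow>
    curve_moment \<beta> (e + 3 * k) = (\<Sum>b<3 * k - 1. x b * curve_moment \<beta> (e + b))"
proof -
  have c: "mon_index k (3 * k) < dim_col (moment_matrix \<beta> k)" using mon_index(1)[of "3 * k" k] k by simp
  have "\<exists>x. \<forall>i<dim_row (moment_matrix \<beta> k). moment_matrix \<beta> k $$ (i, mon_index k (3 * k))
      = (\<Sum>b<3 * k - 1. x b * moment_matrix \<beta> k $$ (i, mon_index k b))"
    by (rule submatrix_rank_eq_in_col_span[OF _ _ _ _ rank c, of "mon_index k" "mon_index k"])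
      (use mon_index mon_index_inj moment_matrix_mon_index[OF cons] in auto)
  then obtain x where x: "\<And>i. i < dim_row (moment_matrix \<beta> k) \<Longrightarrow>
      moment_matrix \<beta> k $$ (i, mon_index k (3 * k))
      = (\<Sum>b<3 * k - 1. x b * moment_matrix \<beta> k $$ (i, mon_index k b))"
    by blast
  show thesis
  proof (rule that)
    fix e assume e: "e \<le> 3 * k" "e \<noteq> 3 * k - 1"
    have "curve_moment \<beta> (e + 3 * k) = moment_matrix \<beta> k $$ (mon_index k e, mon_index k (3 * k))"
      using k by (intro moment_matrix_mon_index[OF cons e, symmetric]) auto
    also have "\<dots> = (\<Sum>b<3 * k - 1. x b * moment_matrix \<beta> k $$ (mon_index k e, mon_index k b))"
      by (rule x) (use mon_index(1)[OF e] in simp)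
    also have "\<dots> = (\<Sum>b<3 * k - 1. x b * curve_moment \<beta> (e + b))"
      using moment_matrix_mon_index[OF cons e] by (intro sum.cong refl) auto
    finally show "curve_moment \<beta> (e + 3 * k) = (\<Sum>b<3 * k - 1. x b * curve_moment \<beta> (e + b))" .
  qed
qed

lemma hankel_flat_relation:
  assumes rank: "mat_rank (hankel (Suc n) g) = mat_rank (hankel n g)"
  obtains x where "\<And>e. e \<le> n \<Longrightarrow> g (e + n) = (\<Sum>b<n. x b * g (e + b))"
proof -
  have "\<exists>x. \<forall>i<dim_row (hankel (Suc n) g). hankel (Suc n) g $$ (i, n)
      = (\<Sum>b<n. x b * hankel (Suc n) g $$ (i, b))"
    by (rule submatrix_rank_eq_in_col_span[OF _ _ _ _ rank, of id id n]) auto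
  then obtain x where x: "\<And>i. i \<le> n \<Longrightarrow> hankel (Suc n) g $$ (i, n) = (\<Sum>b<n. x b * hankel (Suc n) g $$ (i, b))"
    by (auto simp: less_Suc_eq_le)
  show thesis
  proof (rule that)
    fix e assume "e \<le> n"
    then show "g (e + n) = (\<Sum>b<n. x b * g (e + b))" using x[of e] by simp
  qed
qed

section \<open>From column relations to moments that depend only on i + 3j\<close>

lemma column_poly_binomial:
  assumes r: "r < length (monomials k)" and le: "a + b \<le> k" "c + d \<le> k" and ne: "(a, b) \<noteq> (c, d)"
  shows "column_poly \<beta> k (monom (monom 1 a) b - monom (monom 1 c) d) $ r
    = moment_entry \<beta> (monomials k ! r) (a, b) - moment_entry \<beta> (monomials k ! r) (c, d)"
proof -
  have c: "coeff2 (monom (monom 1 a) b - monom (monom 1 c) d) (fst y) (snd y)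
      = (if y = (a, b) then 1 else if y = (c, d) then - 1 else 0)" for y
    using ne by (cases y) (auto simp: coeff2_def)
  have "column_poly \<beta> k (monom (monom 1 a) b - monom (monom 1 c) d) $ r
    = (\<Sum>y\<in>{(i, j). i + j \<le> k}. moment_entry \<beta> (monomials k ! r) y *
        (if y = (a, b) then 1 else if y = (c, d) then - 1 else 0))"
    unfolding column_poly_nth[OF r] c ..
  also have "\<dots> = (\<Sum>y\<in>{(a, b), (c, d)}. moment_entry \<beta> (monomials k ! r) y *
        (if y = (a, b) then 1 else if y = (c, d) then - 1 else 0))"
    using le by (intro sum.mono_neutral_right finite_triangle) auto
  also have "\<dots> = moment_entry \<beta> (monomials k ! r) (a, b) - moment_entry \<beta> (monomials k ! r) (c, d)"
    using ne by auto
  finally show ?thesis .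
qed

lemma moment_column_nth:
  assumes "r < length (monomials k)"
  shows "moment_column \<beta> k i j $ r = moment_entry \<beta> (monomials k ! r) (i, j)"
  using assms by (simp add: moment_column_def moment_entry_def split: prod.split)

lemma dim_column_poly: "dim_vec (column_poly \<beta> k p) = length (monomials k)"
  by (simp add: column_poly_def)

text \<open>The column relation alone compares moments only in rows of degree at most k. Recursive
  generation allows a factor x^a' y^b' of degree at most k-3, and row and factor together reach all
  moments of degree up to 2k.\<close>

lemma cubic_recursion:
  assumes rg: "recursively_generated \<beta> k" and k: "k \<ge> 3"
    and col: "moment_column \<beta> k 0 1 = moment_column \<beta> k 3 0"
    and ab: "a + b + 3 \<le> 2 * k"
  shows "\<beta> (a + 3) b = \<beta> a (b + 1)"
proof -
  define p :: "real poly poly" where "p = monom (monom 1 0) 1 - monom (monom 1 3) 0"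
  have coeff_p: "coeff2 p i j = (if i = 0 \<and> j = 1 then 1 else 0) - (if i = 3 \<and> j = 0 then 1 else 0)" for i j
    by (simp add: p_def coeff2_def)
  have p0: "column_poly \<beta> k p = 0\<^sub>v (length (monomials k))"
  proof (rule eq_vecI)
    fix r assume "r < dim_vec (0\<^sub>v (length (monomials k)))"
    then have r: "r < length (monomials k)" by simp
    show "column_poly \<beta> k p $ r = 0\<^sub>v (length (monomials k)) $ r"
      unfolding p_def
      by (subst column_poly_binomial[OF r])
        (use k r arg_cong[OF col, of "\<lambda>v. v $ r"] in \<open>auto simp: moment_column_nth\<close>)
  qed (simp add: dim_column_poly)
  \<comment> \<open>The row absorbs as much of the exponents as degree k permits; what is left has
    degree at most k-3.\<close>
  define i where "i = min a k"
  define j where "j = min b (k - i)"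
  define a' where "a' = a - i"
  define b' where "b' = b - j"
  have eq: "a = i + a'" "b = j + b'" "i + j \<le> k" by (auto simp: i_def j_def a'_def b'_def)
  have ab': "a' + b' + 3 \<le> k"
    using ab k by (auto simp: i_def j_def a'_def b'_def min_def split: if_splits)
  define q :: "real poly poly" where "q = monom (monom 1 a') b'"
  have pq: "p * q = monom (monom 1 a') (b' + 1) - monom (monom 1 (a' + 3)) b'"
    by (simp add: p_def q_def left_diff_distrib mult_monom add.commute)
  have "total_degree_le p k"
    unfolding total_degree_le_def coeff_p using k by auto
  moreover have "total_degree_le q k"
    unfolding total_degree_le_def q_def coeff2_def using ab' by auto
  moreover have "total_degree_le (p * q) k"
    unfolding total_degree_le_def pq coeff2_def using ab' by (auto split: if_splits)
  ultimately have pq0: "column_poly \<beta> k (p * q) = 0\<^sub>v (length (monomials k))"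
    using rg p0 unfolding recursively_generated_def by blast
  have "(i, j) \<in> set (monomials k)" using eq(3) by (simp add: set_monomials)
  then obtain r where r: "r < length (monomials k)" "monomials k ! r = (i, j)"
    by (auto simp: in_set_conv_nth)
  have "0 = column_poly \<beta> k (p * q) $ r" using pq0 r(1) by simp
  also have "\<dots> = moment_entry \<beta> (i, j) (a', b' + 1) - moment_entry \<beta> (i, j) (a' + 3, b')"
    unfolding pq by (subst column_poly_binomial[OF r(1)]) (use ab' r(2) in auto)
  finally show ?thesis by (simp add: moment_entry_def eq add.assoc)
qed

lemma curve_moment_eq_if_recursion:
  assumes step: "\<And>a b. a + b + 3 \<le> n \<Longrightarrow> \<beta> (a + 3) b = \<beta> a (b + 1)"
    and "i + j \<le> n"
  shows "\<beta> i j = curve_moment \<beta> (i + 3 * j)"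
  using assms(2)
proof (induction i arbitrary: j rule: less_induct)
  case (less i)
  show ?case
  proof (cases "i < 3")
    case True
    then show ?thesis by (simp add: curve_moment_def)
  next
    case False
    then obtain a where a: "i = a + 3" by (metis add.commute le_Suc_ex not_less)
    have "\<beta> i j = \<beta> a (j + 1)" using step[of a j] less.prems a by simp
    also have "\<dots> = curve_moment \<beta> (a + 3 * (j + 1))" using less.prems a by (intro less.IH) auto
    finally show ?thesis by (simp add: a algebra_simps)
  qed
qed

text \<open>For k = 2 the three equalities are precisely the instances of the recursion within
  degree 4; for k = 1 there is no instance.\<close>

lemma moments_on_curve:
  assumes "k \<ge> 1" and rg: "recursively_generated \<beta> k"
    and col: "k \<ge> 3 \<Longrightarrow> moment_column \<beta> k 0 1 = moment_column \<beta> k 3 0"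
    and two: "k = 2 \<Longrightarrow> \<beta> 0 1 = \<beta> 3 0 \<and> \<beta> 1 1 = \<beta> 4 0 \<and> \<beta> 0 2 = \<beta> 3 1"
    and "i + j \<le> 2 * k"
  shows "\<beta> i j = curve_moment \<beta> (i + 3 * j)"
proof (rule curve_moment_eq_if_recursion[OF _ assms(5)])
  fix a b assume ab: "a + b + 3 \<le> 2 * k"
  consider "k = 1" | "k = 2" | "k \<ge> 3" using assms(1) by linarith
  then show "\<beta> (a + 3) b = \<beta> a (b + 1)"
  proof cases
    case 1
    with ab show ?thesis by simp
  next
    case 2
    then consider "a = 0" "b = 0" | "a = 1" "b = 0" | "a = 0" "b = 1" using ab by linarith
    then show ?thesis using two[OF 2] by cases (simp_all add: numeral_2_eq_2)
  next
    case 3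
    then show ?thesis using cubic_recursion[OF rg 3 col[OF 3] ab] by simp
  qed
qed

section \<open>Measures on the cubic\<close>

definition curve_point :: "real \<Rightarrow> real \<times> real" where
  "curve_point t = (t, t ^ 3)"

lemma curve_point_simps [simp]: "fst (curve_point t) = t" "snd (curve_point t) = t ^ 3"
  by (simp_all add: curve_point_def)

lemma curve_point_in [simp]: "curve_point t \<in> cubic_curve"
  by (simp add: curve_point_def cubic_curve_def)

lemma cubic_curve_iff: "z \<in> cubic_curve \<longleftrightarrow> z = curve_point (fst z)"
  by (cases z) (auto simp: curve_point_def cubic_curve_def)

lemma closed_cubic_curve: "closed cubic_curve"
proof -
  have eq: "cubic_curve = {z. snd z = fst z ^ 3}" by (auto simp: cubic_curve_def)
  show ?thesis unfolding eq by (intro closed_Collect_eq continuous_intros)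
qed

lemma cubic_curve_borel [measurable]: "cubic_curve \<in> sets borel"
  using closed_cubic_curve by (rule borel_closed)

lemma fst_borel [measurable]: "fst \<in> borel_measurable (borel :: (real \<times> real) measure)"
  by (intro borel_measurable_continuous_onI continuous_intros)

lemma curve_monomial: "z \<in> cubic_curve \<Longrightarrow> (case z of (x, y) \<Rightarrow> x ^ i * y ^ j) = fst z ^ (i + 3 * j)"
  by (auto simp: cubic_curve_def power_add power_mult)

lemma representing_measure_on_cubic_iff:
  "representing_measure_on \<beta> k cubic_curve \<mu> \<longleftrightarrow>
     sets \<mu> = sets borel \<and> measure_support \<mu> \<subseteq> cubic_curve \<and>
     (\<forall>i j. i + j \<le> 2 * k \<longrightarrow>
        integrable \<mu> (\<lambda>z. indicator cubic_curve z * fst z ^ (i + 3 * j)) \<and>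
        \<beta> i j = (\<integral>z. indicator cubic_curve z * fst z ^ (i + 3 * j) \<partial>\<mu>))"
proof -
  have "(\<lambda>z. indicat_real cubic_curve z *\<^sub>R (case z of (x, y) \<Rightarrow> x ^ i * y ^ j))
      = (\<lambda>z. indicator cubic_curve z * fst z ^ (i + 3 * j))" for i j :: nat
    by (rule ext) (simp add: indicator_def curve_monomial)
  then show ?thesis
    unfolding representing_measure_on_def set_integrable_def set_lebesgue_integral_def by simp
qed

lemma representing_measure_of_atoms:
  assumes S: "finite S" "\<And>s. s \<in> S \<Longrightarrow> 0 < w s"
    and \<beta>: "\<And>i j. i + j \<le> 2 * k \<Longrightarrow> \<beta> i j = (\<Sum>s\<in>S. w s * s ^ (i + 3 * j))"
  shows "\<exists>\<mu>. representing_measure_on \<beta> k cubic_curve \<mu> \<and> atomic (card S) \<mu>"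
proof -
  define \<nu> where "\<nu> = point_measure S (\<lambda>s. ennreal (w s))"
  define \<mu> where "\<mu> = distr \<nu> borel curve_point"
  have meas: "curve_point \<in> measurable \<nu> borel"
    unfolding \<nu>_def by (simp add: measurable_point_measure_eq1)
  have sets: "sets \<mu> = sets borel" by (simp add: \<mu>_def)
  have inj: "inj_on curve_point S" by (auto simp: inj_on_def curve_point_def)
  have em: "emeasure \<mu> B = (\<Sum>z\<in>curve_point ` S. ennreal (w (fst z)) * indicator B z)"
    if B: "B \<in> sets borel" for B
  proof -
    have "emeasure \<mu> B = emeasure \<nu> (curve_point -` B \<inter> S)"
      unfolding \<mu>_def using B meas by (subst emeasure_distr) (auto simp: \<nu>_def space_point_measure)
    also have "\<dots> = (\<Sum>s\<in>curve_point -` B \<inter> S. ennreal (w s))"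
      unfolding \<nu>_def using S by (intro emeasure_point_measure_finite) auto
    also have "\<dots> = (\<Sum>s\<in>S. ennreal (w s) * indicator B (curve_point s))"
      using S(1) by (intro sum.mono_neutral_cong_left) (auto simp: indicator_def)
    also have "\<dots> = (\<Sum>z\<in>curve_point ` S. ennreal (w (fst z)) * indicator B z)"
      by (simp add: sum.reindex[OF inj])
    finally show ?thesis .
  qed
  have "representing_measure_on \<beta> k cubic_curve \<mu>"
    unfolding representing_measure_on_cubic_iff
  proof (intro conjI allI impI)
    show "measure_support \<mu> \<subseteq> cubic_curve"
    proof
      fix z assume z: "z \<in> measure_support \<mu>"
      show "z \<in> cubic_curve"
      proof (rule ccontr)
        assume "z \<notin> cubic_curve"
        \<comment> \<open>The complement of the curve is open and contains no atom, so it contains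
          no point of the support.\<close>
        then have "0 < emeasure \<mu> (- cubic_curve)"
          using z closed_cubic_curve unfolding measure_support_def by auto
        moreover have "emeasure \<mu> (- cubic_curve) = 0"
          by (subst em) (auto simp: borel_comp S(1) indicator_def)
        ultimately show False by simp
      qed
    qed
    fix i j :: nat assume ij: "i + j \<le> 2 * k"
    let ?f = "\<lambda>z. indicator cubic_curve z * fst z ^ (i + 3 * j) :: real"
    have f: "?f \<in> borel_measurable borel" by measurable
    show "integrable \<mu> ?f"
      unfolding \<mu>_def integrable_distr_eq[OF meas f] unfolding \<nu>_def
      by (rule integrable_point_measure_finite[OF S(1)])
    have "(\<integral>z. ?f z \<partial>\<mu>) = (\<integral>s. ?f (curve_point s) \<partial>\<nu>)"
      unfolding \<mu>_def by (rule integral_distr[OF meas f])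
    also have "\<dots> = (\<Sum>s\<in>S. w s * s ^ (i + 3 * j))"
      unfolding \<nu>_def using S
      by (subst lebesgue_integral_point_measure_finite) (auto intro: less_imp_le)
    finally show "\<beta> i j = (\<integral>z. ?f z \<partial>\<mu>)" using \<beta>[OF ij] by simp
  qed (rule sets)
  moreover have "atomic (card S) \<mu>"
    unfolding atomic_def
    using S sets em card_image[OF inj]
    by (intro exI[of _ "curve_point ` S"] exI[of _ "\<lambda>z. w (fst z)"]) auto
  ultimately show ?thesis by (intro exI[of _ \<mu>] conjI)
qed

text \<open>Each point outside the support has an open null neighbourhood; by second countability
  countably many of these cover all such points.\<close>

lemma AE_in_closed_superset_support:
  fixes \<mu> :: "'a::second_countable_topology measure"
  assumes sets: "sets \<mu> = sets borel" and K: "measure_support \<mu> \<subseteq> K"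
  shows "AE z in \<mu>. z \<in> K"
proof -
  define F where "F = {U. open U \<and> emeasure \<mu> U = 0}"
  have "\<And>U. U \<in> F \<Longrightarrow> open U" by (simp add: F_def)
  from Lindelof[OF this] obtain F' where F': "F' \<subseteq> F" "countable F'" "\<Union>F' = \<Union>F" .
  have "U \<in> null_sets \<mu>" if "U \<in> F'" for U
    using subsetD[OF F'(1) that] sets by (simp add: F_def null_sets_def)
  then have "(\<Union>U\<in>F'. U) \<in> null_sets \<mu>" by (rule null_sets_UN'[OF F'(2)])
  then have "\<Union>F' \<in> null_sets \<mu>" by simp
  then show ?thesis
  proof (rule AE_I')
    show "{z \<in> space \<mu>. z \<notin> K} \<subseteq> \<Union>F'"
    proof
      fix z assume "z \<in> {z \<in> space \<mu>. z \<notin> K}"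
      then have "z \<notin> measure_support \<mu>" using K by blast
      then obtain U where "open U" "z \<in> U" "\<not> 0 < emeasure \<mu> U"
        unfolding measure_support_def by blast
      then have "z \<in> \<Union>F" by (auto simp: F_def not_gr_zero)
      then show "z \<in> \<Union>F'" using F'(3) by simp
    qed
  qed
qed

text \<open>Degree at most 6k-2 stays below the missing exponent, so every coefficient of
  \<open>F\<close> meets a genuine moment.\<close>

lemma representing_measure_moments:
  assumes rep: "representing_measure_on \<beta> k cubic_curve \<mu>" and k: "k \<ge> 1"
  shows "i + j \<le> 2 * k \<Longrightarrow> \<beta> i j = curve_moment \<beta> (i + 3 * j)"
    and "degree F \<le> 6 * k - 2 \<Longrightarrow>
      integrable \<mu> (\<lambda>z. indicator cubic_curve z * poly F (fst z)) \<and>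
      momL (curve_moment \<beta>) F = (\<integral>z. indicator cubic_curve z * poly F (fst z) \<partial>\<mu>)"
proof -
  define m where "m d = (\<lambda>z. indicator cubic_curve z * fst z ^ d :: real)" for d :: nat
  have \<beta>: "integrable \<mu> (m (i + 3 * j))" "\<beta> i j = integral\<^sup>L \<mu> (m (i + 3 * j))" if "i + j \<le> 2 * k" for i j
    using rep that unfolding representing_measure_on_cubic_iff m_def by blast+
  have curve: "integrable \<mu> (m d)" "curve_moment \<beta> d = integral\<^sup>L \<mu> (m d)"
    if "d \<le> 3 * (2 * k)" "d \<noteq> 3 * (2 * k) - 1" for d
    using \<beta>[OF mod_div_in_triangle[OF that]] by (simp_all add: curve_moment_def)
  show "\<beta> i j = curve_moment \<beta> (i + 3 * j)" if "i + j \<le> 2 * k"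
    using \<beta>[OF that] curve[OF triangle_exponent[OF _ that]] k by simp
  assume F: "degree F \<le> 6 * k - 2"
  have F_eq: "(\<lambda>z. indicator cubic_curve z * poly F (fst z)) = (\<lambda>z. \<Sum>d\<le>degree F. poly.coeff F d * m d z)"
    unfolding m_def by (rule ext) (simp add: poly_altdef sum_distrib_left mult_ac)
  have int: "integrable \<mu> (m d)" "curve_moment \<beta> d = integral\<^sup>L \<mu> (m d)" if "d \<le> degree F" for d
    using curve[of d] that F k by auto
  show "integrable \<mu> (\<lambda>z. indicator cubic_curve z * poly F (fst z)) \<and>
      momL (curve_moment \<beta>) F = (\<integral>z. indicator cubic_curve z * poly F (fst z) \<partial>\<mu>)"
    unfolding F_eq using int by (auto simp: momL_def intro!: sum.cong)
qed

lemma representing_measure_nonneg: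
  assumes rep: "representing_measure_on \<beta> k cubic_curve \<mu>" and k: "k \<ge> 1"
    and f: "degree f \<le> 3 * k - 1"
  shows "0 \<le> momL (curve_moment \<beta>) (f * f)"
proof -
  have "degree (f * f) \<le> 6 * k - 2" using degree_mult_le[of f f] f by simp
  then show ?thesis
    using representing_measure_moments(2)[OF rep k, of "f * f"]
    by (auto intro!: integral_nonneg_AE)
qed

text \<open>A vanishing integral of f^2 confines the measure to the points of the curve above the
  zeros of \<open>f\<close>. The conclusion concerns the given \<open>\<mu>\<close>, which is what
  the claim about every measure in the singular case requires.\<close>

lemma representing_measure_null_poly:
  assumes rep: "representing_measure_on \<beta> k cubic_curve \<mu>" and k: "k \<ge> 1"
    and f: "f \<noteq> 0" "degree f \<le> 3 * k - 1" "momL (curve_moment \<beta>) (f * f) = 0"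
  obtains S w where "finite S" "card S \<le> degree f" "\<And>s. s \<in> S \<Longrightarrow> 0 < w s" "atomic (card S) \<mu>"
    "\<And>i j. i + j \<le> 2 * k \<Longrightarrow> \<beta> i j = (\<Sum>s\<in>S. w s * s ^ (i + 3 * j))"
proof -
  note rep' = rep[unfolded representing_measure_on_cubic_iff]
  have sets [measurable_cong]: "sets \<mu> = sets borel" using rep' by blast
  have space: "space \<mu> = UNIV" using sets_eq_imp_space_eq[OF sets] by simp
  have AE_K: "AE z in \<mu>. z \<in> cubic_curve"
    by (rule AE_in_closed_superset_support) (use rep' in blast)+
  have moments: "integrable \<mu> (\<lambda>z. indicator cubic_curve z * fst z ^ (i + 3 * j)) \<and>
      \<beta> i j = (\<integral>z. indicator cubic_curve z * fst z ^ (i + 3 * j) \<partial>\<mu>)" if "i + j \<le> 2 * k" for i j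
    using rep' that by simp
  \<comment> \<open>The moment of index (0, 0) is the total mass on the curve, hence finite.\<close>
  have "integrable \<mu> (indicat_real cubic_curve)"
    using moments[of 0 0] by simp
  then have "emeasure \<mu> cubic_curve < \<infinity>"
    by (simp add: integrable_indicator_iff space)
  moreover have "emeasure \<mu> (space \<mu>) = emeasure \<mu> cubic_curve"
    by (rule emeasure_eq_AE) (use AE_K in \<open>auto simp: space sets\<close>)
  ultimately interpret finite_measure \<mu> by (intro finite_measureI) auto
  have deg: "degree (f * f) \<le> 6 * k - 2" using degree_mult_le[of f f] f(2) by simp
  note int = representing_measure_moments(2)[OF rep k deg]
  have "AE z in \<mu>. indicator cubic_curve z * poly (f * f) (fst z) = 0"
    using integral_nonneg_eq_0_iff_AE[OF conjunct1[OF int]] int f(3) by auto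
  with AE_K have AE_root: "AE z in \<mu>. z \<in> cubic_curve \<and> poly f (fst z) = 0"
    by eventually_elim auto
  define Z where "Z = {t. poly f t = 0}"
  have finZ: "finite Z" unfolding Z_def by (rule poly_roots_finite[OF f(1)])
  have AE_Z: "AE z in \<mu>. z \<in> curve_point ` Z"
    using AE_root by eventually_elim (auto simp: Z_def cubic_curve_iff)
  define w where "w t = measure \<mu> {curve_point t}" for t
  \<comment> \<open>A zero of \<open>f\<close> may carry no mass; only those with positive mass are
    atoms.\<close>
  define S where "S = {t \<in> Z. 0 < w t}"
  have finS: "finite S" using finZ by (simp add: S_def)
  have inj: "inj_on curve_point A" for A by (auto simp: inj_on_def curve_point_def)
  have single: "{z} \<in> sets \<mu>" for z by (simp add: sets)
  have w0: "w t = 0" if "t \<in> Z" "t \<notin> S" for t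
    using that unfolding S_def w_def by (simp add: not_less antisym)
  have SZ: "S \<subseteq> Z" by (auto simp: S_def)
  have em: "emeasure \<mu> B = (\<Sum>z\<in>curve_point ` S. ennreal (w (fst z)) * indicator B z)"
    if B: "B \<in> sets borel" for B
  proof -
    have "emeasure \<mu> B = emeasure \<mu> (B \<inter> curve_point ` Z)"
      by (rule emeasure_eq_AE) (use AE_Z B finZ in \<open>auto simp: sets intro: borel_closed finite_imp_closed\<close>)
    also have "\<dots> = (\<Sum>z\<in>B \<inter> curve_point ` Z. emeasure \<mu> {z})"
      by (rule emeasure_eq_sum_singleton) (use finZ single in auto)
    also have "\<dots> = (\<Sum>z\<in>curve_point ` Z. emeasure \<mu> {z} * indicator B z)"
      using finZ by (intro sum.mono_neutral_cong_left) (auto simp: indicator_def)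
    also have "\<dots> = (\<Sum>t\<in>Z. ennreal (w t) * indicator B (curve_point t))"
      by (simp add: sum.reindex[OF inj] w_def emeasure_eq_measure)
    also have "\<dots> = (\<Sum>t\<in>S. ennreal (w t) * indicator B (curve_point t))"
      by (rule sum.mono_neutral_right[OF finZ SZ]) (simp add: w0)
    also have "\<dots> = (\<Sum>z\<in>curve_point ` S. ennreal (w (fst z)) * indicator B z)"
      by (simp add: sum.reindex[OF inj])
    finally show ?thesis .
  qed
  have "card S \<le> card Z" by (rule card_mono[OF finZ SZ])
  also have "\<dots> \<le> degree f" unfolding Z_def by (rule card_poly_roots_bound[OF f(1)])
  finally have card: "card S \<le> degree f" .
  have at: "atomic (card S) \<mu>"
    unfolding atomic_def
    using finS sets em card_image[OF inj, of S]
    by (intro exI[of _ "curve_point ` S"] exI[of _ "\<lambda>z. w (fst z)"]) (auto simp: S_def)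
  have mom: "\<beta> i j = (\<Sum>s\<in>S. w s * s ^ (i + 3 * j))" if ij: "i + j \<le> 2 * k" for i j
  proof -
    define d where "d = i + 3 * j"
    have "\<beta> i j = (\<integral>z. indicator cubic_curve z * fst z ^ d \<partial>\<mu>)"
      using moments[OF ij] unfolding d_def by simp
    also have "\<dots> = (\<integral>z. (\<Sum>t\<in>Z. indicator {curve_point t} z * t ^ d) \<partial>\<mu>)"
    proof (rule integral_cong_AE)
      show "AE z in \<mu>. indicator cubic_curve z * fst z ^ d = (\<Sum>t\<in>Z. indicator {curve_point t} z * t ^ d)"
        using AE_Z
      proof eventually_elim
        fix z assume "z \<in> curve_point ` Z"
        then obtain t where t: "t \<in> Z" "z = curve_point t" by blast
        have "(\<Sum>t'\<in>Z. indicator {curve_point t'} z * t' ^ d) = (\<Sum>t'\<in>Z. if t' = t then t ^ d else 0)"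
          using t(2) by (intro sum.cong refl) (auto simp: indicator_def curve_point_def)
        then show "indicator cubic_curve z * fst z ^ d = (\<Sum>t\<in>Z. indicator {curve_point t} z * t ^ d)"
          using t finZ by simp
      qed
    qed measurable
    also have "\<dots> = (\<Sum>t\<in>Z. w t * t ^ d)"
      using single
      by (subst Bochner_Integration.integral_sum)
        (auto simp: w_def space integrable_indicator_iff emeasure_eq_measure)
    also have "\<dots> = (\<Sum>t\<in>S. w t * t ^ d)"
      by (rule sum.mono_neutral_right[OF finZ SZ]) (simp add: w0)
    finally show ?thesis by (simp add: d_def)
  qed
  show thesis
    by (rule that[OF finS card _ at mom]) (auto simp: S_def)
qed

section \<open>Definiteness versus invertibility, and the two constructions of atoms\<close>

lemma hankel_mult_vec_coeff:
  assumes "degree f \<le> n" "i \<le> n"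
  shows "(hankel (Suc n) g *\<^sub>v vec (Suc n) (poly.coeff f)) $ i = momL g (f * monom 1 i)"
proof -
  have "(hankel (Suc n) g *\<^sub>v vec (Suc n) (poly.coeff f)) $ i = (\<Sum>j<Suc n. g (i + j) * poly.coeff f j)"
    using assms(2)
    by (auto simp: scalar_prod_def atLeast0LessThan simp del: sum.lessThan_Suc intro!: sum.cong)
  also have "\<dots> = momL g (monom 1 i * f)"
    unfolding momL_mult_right[OF assms(1)] lessThan_Suc_atMost by (simp add: mult_monom mult.commute add.commute)
  finally show ?thesis by (simp add: mult.commute)
qed

text \<open>By \<open>momL_null_kernel\<close> a null polynomial would give a nonzero kernel vector.
  This links the nonsingular case of the atom count to alternative (a).\<close>

lemma pos_def_hankel_if_invertible:
  assumes psd: "\<And>f. degree f \<le> n \<Longrightarrow> 0 \<le> momL g (f * f)"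
    and inv: "invertible_mat (hankel (Suc n) g)"
  shows "pos_def (hankel (Suc n) g)"
  unfolding pos_def_hankel_iff
proof (intro allI impI)
  fix f :: "real poly" assume f: "f \<noteq> 0" "degree f \<le> n"
  let ?A = "hankel (Suc n) g" and ?v = "vec (Suc n) (poly.coeff f)"
  obtain B where B: "B * ?A = 1\<^sub>m (dim_row B)" "?A * B = 1\<^sub>m (Suc n)"
    using inv unfolding invertible_mat_def inverts_mat_def by auto
  have dims: "dim_row B = Suc n" "dim_col B = Suc n"
    using arg_cong[OF B(1), of dim_col] arg_cong[OF B(2), of dim_col] by simp_all
  then have BA: "B * ?A = 1\<^sub>m (Suc n)" "B \<in> carrier_mat (Suc n) (Suc n)"
    using B(1) by auto
  have "momL g (f * f) \<noteq> 0"
  proof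
    assume "momL g (f * f) = 0"
    from momL_null_kernel[OF psd f(2) this] have "?A *\<^sub>v ?v = 0\<^sub>v (Suc n)"
      by (intro eq_vecI) (simp_all add: hankel_mult_vec_coeff[OF f(2)] degree_monom_eq del: index_mult_mat_vec)
    then have "B *\<^sub>v (?A *\<^sub>v ?v) = 0\<^sub>v (Suc n)" using BA(2) by auto
    moreover have "B *\<^sub>v (?A *\<^sub>v ?v) = (B * ?A) *\<^sub>v ?v"
      by (rule assoc_mult_mat_vec[OF BA(2) hankel_dims(1), symmetric]) simp
    ultimately have "?v = 0\<^sub>v (Suc n)" unfolding BA(1) by simp
    then have "?v $ degree f = 0" using f(2) by (metis index_zero_vec(1) less_Suc_eq_le)
    then show False using f by simp
  qed
  then show "0 < momL g (f * f)" using psd[OF f(2)] by simp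
qed

lemma invertible_if_pos_def:
  assumes "pos_def A"
  shows "invertible_mat A"
proof -
  define n where "n = dim_row A"
  have A: "A \<in> carrier_mat n n" using assms by (auto simp: n_def pos_def_def)
  have "det A \<noteq> 0"
  proof
    assume "det A = 0"
    then obtain v where v: "v \<in> carrier_vec n" "v \<noteq> 0\<^sub>v n" "A *\<^sub>v v = 0\<^sub>v n"
      using det_0_iff_vec_prod_zero_field[OF A] by blast
    have "0 < v \<bullet> (A *\<^sub>v v)" using assms v(1,2) unfolding pos_def_def n_def by blast
    then show False using v(1,3) by simp
  qed
  from det_non_zero_imp_unit[OF A this, of "()"]
  obtain B where "B \<in> carrier_mat n n" "B * A = 1\<^sub>m n" "A * B = 1\<^sub>m n"
    unfolding Units_def ring_mat_def by auto
  then show ?thesis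
    using A unfolding invertible_mat_def inverts_mat_def by auto
qed

text \<open>With n = 3k-1 the free moment 2n+1 is the missing 6k-1, and positivity of M(k) supplies
  the inequality at the top degree 2n+2 = 6k.\<close>

lemma atoms_of_pos_def:
  assumes k: "k \<ge> 1"
    and cons: "\<And>i j. i + j \<le> 2 * k \<Longrightarrow> \<beta> i j = curve_moment \<beta> (i + 3 * j)"
    and psd: "pos_semidef (moment_matrix \<beta> k)"
    and pd: "pos_def (hankel (3 * k) (curve_moment \<beta>))"
  obtains S w where "finite S" "card S = 3 * k" "\<And>s. s \<in> S \<Longrightarrow> 0 < w s"
    "\<And>i j. i + j \<le> 2 * k \<Longrightarrow> \<beta> i j = (\<Sum>s\<in>S. w s * s ^ (i + 3 * j))"
proof -
  define n where "n = 3 * k - 1"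
  have n: "3 * k = Suc n" "3 * (2 * k) = 2 * Suc n" using k by (simp_all add: n_def)
  have pd': "0 < momL (curve_moment \<beta>) (f * f)" if "f \<noteq> 0" "degree f < Suc n" for f
    using pd that unfolding n pos_def_hankel_iff by simp
  have gap: "0 \<le> momL (curve_moment \<beta>) ((monom 1 (Suc n) - c) * (monom 1 (Suc n) - c))"
    if c: "\<forall>i\<ge>n. poly.coeff c i = 0" for c
  proof (rule moment_matrix_gap_nonneg[OF cons psd _ _ k])
    show "degree (monom 1 (Suc n) - c) \<le> 3 * k"
      unfolding n by (rule degree_le) (use c in auto)
    show "poly.coeff (monom 1 (Suc n) - c) (3 * k - 1) = 0" using c by (simp add: n)
  qed
  show thesis
  proof (rule quadrature_of_pos_def_gap[OF pd' gap])
    fix S w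
    assume S: "finite S" "card S = Suc n" "\<And>s. s \<in> S \<Longrightarrow> 0 < w s"
      "\<And>i. i \<le> 2 * Suc n \<Longrightarrow> i \<noteq> 2 * n + 1 \<Longrightarrow> curve_moment \<beta> i = (\<Sum>s\<in>S. w s * s ^ i)"
    show thesis
    proof (rule that[OF S(1) _ S(3)])
      show "card S = 3 * k" using S(2) n(1) by simp
      fix i j assume ij: "i + j \<le> 2 * k"
      show "\<beta> i j = (\<Sum>s\<in>S. w s * s ^ (i + 3 * j))"
        unfolding cons[OF ij] using triangle_exponent[OF _ ij] k n by (intro S(4)) auto
    qed
  qed
qed

text \<open>Testing against the polynomial that vanishes at all atoms but \<open>t\<close>, of
  degree |S|-1 < n, isolates the value at \<open>t\<close>.\<close>

lemma atoms_orthogonal_zero: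
  assumes S: "finite S" "\<And>s. s \<in> S \<Longrightarrow> 0 < w s" "card S \<le> n"
    and orth: "\<And>e. e < n \<Longrightarrow> (\<Sum>s\<in>S. w s * s ^ e * Q s) = 0" and t: "t \<in> S"
  shows "Q t = (0 :: real)"
proof -
  define R where "R = (\<Prod>s\<in>S - {t}. [:- s, 1:])"
  have "0 < card S" using S(1) t by (auto simp: card_gt_0_iff)
  then have "degree R < n"
    using degree_prod_sum_le[of "S - {t}" "\<lambda>s. [:- s, 1:]"] S(1,3) t by (simp add: R_def o_def)
  have "0 = (\<Sum>e\<le>degree R. poly.coeff R e * (\<Sum>s\<in>S. w s * s ^ e * Q s))"
    using orth \<open>degree R < n\<close> by simp
  also have "\<dots> = (\<Sum>e\<le>degree R. \<Sum>s\<in>S. w s * Q s * (poly.coeff R e * s ^ e))"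
    by (simp add: sum_distrib_left mult_ac)
  also have "\<dots> = (\<Sum>s\<in>S. \<Sum>e\<le>degree R. w s * Q s * (poly.coeff R e * s ^ e))" by (rule sum.swap)
  also have "\<dots> = (\<Sum>s\<in>S. w s * Q s * poly R s)" by (simp add: poly_altdef sum_distrib_left)
  also have "\<dots> = (\<Sum>s\<in>S. if s = t then w t * Q t * poly R t else 0)"
    using S(1) by (intro sum.cong refl) (auto simp: R_def poly_prod)
  also have "\<dots> = w t * Q t * poly R t" using S(1) t by simp
  finally show ?thesis using S(1) S(2)[OF t] by (auto simp: R_def poly_prod)
qed

lemma atoms_of_flat:
  assumes k: "k \<ge> 1"
    and cons: "\<And>i j. i + j \<le> 2 * k \<Longrightarrow> \<beta> i j = curve_moment \<beta> (i + 3 * j)"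
    and psd: "pos_semidef (hankel (3 * k) (curve_moment \<beta>))"
    and rank1: "mat_rank (hankel (3 * k - 1) (curve_moment \<beta>)) = mat_rank (hankel (3 * k) (curve_moment \<beta>))"
    and rank2: "mat_rank (hankel (3 * k) (curve_moment \<beta>)) = mat_rank (moment_matrix \<beta> k)"
  obtains S w where "finite S" "\<And>s. s \<in> S \<Longrightarrow> 0 < w s"
    "\<And>i j. i + j \<le> 2 * k \<Longrightarrow> \<beta> i j = (\<Sum>s\<in>S. w s * s ^ (i + 3 * j))"
proof -
  define g where "g = curve_moment \<beta>"
  define n where "n = 3 * k - 1"
  have n: "3 * k = Suc n" "3 * (2 * k) = 2 * Suc n" using k by (simp_all add: n_def)
  obtain x where x: "\<And>e. e \<le> n \<Longrightarrow> g (e + n) = (\<Sum>b<n. x b * g (e + b))"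
    using hankel_flat_relation[of n g] rank1 n unfolding g_def by auto
  define q where "q = monom 1 n - (\<Sum>b<n. monom (x b) b)"
  have cq: "poly.coeff q n = 1" "\<And>i. i > n \<Longrightarrow> poly.coeff q i = 0"
    by (auto simp: q_def coeff_sum)
  have dq: "degree q = n"
    by (intro antisym degree_le le_degree) (use cq in auto)
  have orth_q: "momL g (q * monom 1 e) = 0" if "e \<le> n" for e
    using x[OF that]
    by (simp add: q_def left_diff_distrib sum_distrib_right mult_monom momL_diff momL_sum add.commute)
  have psd': "0 \<le> momL g (f * f)" if "degree f \<le> n" for f
    using psd that unfolding n pos_semidef_hankel_iff g_def by blast
  obtain y where y: "\<And>e. e \<le> 3 * k \<Longrightarrow> e \<noteq> 3 * k - 1 \<Longrightarrow>
      g (e + 3 * k) = (\<Sum>b<3 * k - 1. y b * g (e + b))"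
    using moment_matrix_flat_relation[OF cons _ k] rank1 rank2 unfolding g_def by auto
  show thesis
  proof (rule quadrature_of_flat[OF psd' dq cq(1) orth_q])
    fix S w
    assume S: "finite S" "card S \<le> n" "\<And>s. s \<in> S \<Longrightarrow> 0 < w s"
      "\<And>i. i \<le> 2 * n \<Longrightarrow> g i = (\<Sum>s\<in>S. w s * s ^ i)"
    \<comment> \<open>The relation of column x^(3k) as a function on the atoms. Its rows e < n
      involve only moments up to 2n, which the quadrature already reproduces; they force it to
      vanish at every atom.\<close>
    define Q where "Q s = s ^ Suc n - (\<Sum>b<n. y b * s ^ b)" for s :: real
    have sum_Q: "(\<Sum>s\<in>S. w s * s ^ e * Q s) =
        (\<Sum>s\<in>S. w s * s ^ (e + Suc n)) - (\<Sum>b<n. y b * (\<Sum>s\<in>S. w s * s ^ (e + b)))" for e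
    proof -
      have "(\<Sum>s\<in>S. w s * s ^ e * Q s) =
          (\<Sum>s\<in>S. w s * s ^ (e + Suc n)) - (\<Sum>s\<in>S. \<Sum>b<n. y b * (w s * s ^ (e + b)))"
        by (simp add: Q_def right_diff_distrib sum_subtractf sum_distrib_left power_add mult_ac)
      also have "(\<Sum>s\<in>S. \<Sum>b<n. y b * (w s * s ^ (e + b))) = (\<Sum>b<n. \<Sum>s\<in>S. y b * (w s * s ^ (e + b)))"
        by (rule sum.swap)
      finally show ?thesis by (simp add: sum_distrib_left)
    qed
    have orth: "(\<Sum>s\<in>S. w s * s ^ e * Q s) = 0" if "e < n" for e
      using that y[of e] S(4)[of "e + Suc n"] unfolding sum_Q n
      by (simp add: S(4)[symmetric])
    have Q0: "Q s = 0" if "s \<in> S" for s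
      by (rule atoms_orthogonal_zero[OF S(1,3,2) orth that])
    \<comment> \<open>Row 3k of the relation expresses g(6k) by moments up to 2n, and the atoms
      satisfy the same relation.\<close>
    have "g (Suc n + Suc n) = (\<Sum>b<n. y b * g (Suc n + b))"
      using y[of "Suc n"] n by simp
    also have "\<dots> = (\<Sum>b<n. y b * (\<Sum>s\<in>S. w s * s ^ (Suc n + b)))"
      by (intro sum.cong refl) (simp add: S(4))
    also have "\<dots> = (\<Sum>s\<in>S. w s * s ^ (Suc n + Suc n))"
      using sum_Q[of "Suc n"] Q0 by simp
    finally have top: "g (2 * Suc n) = (\<Sum>s\<in>S. w s * s ^ (2 * Suc n))" by (simp add: mult_2)
    show thesis
    proof (rule that[OF S(1,3)])
      fix i j assume ij: "i + j \<le> 2 * k"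
      have "i + 3 * j \<le> 2 * Suc n" "i + 3 * j \<noteq> 2 * n + 1"
        using triangle_exponent[OF _ ij] k n by auto
      then have "g (i + 3 * j) = (\<Sum>s\<in>S. w s * s ^ (i + 3 * j))"
        using S(4)[of "i + 3 * j"] top by (cases "i + 3 * j = 2 * Suc n") auto
      then show "\<beta> i j = (\<Sum>s\<in>S. w s * s ^ (i + 3 * j))" unfolding cons[OF ij] g_def .
    qed
  qed
qed

text \<open>Below definiteness some nonzero \<open>f\<close> of degree at most 3k-1 is null, so the
  measure has at most 3k-1 atoms. That is few enough for all three matrices to have the number of
  atoms as rank.\<close>

lemma representing_measure_singular:
  assumes k: "k \<ge> 1" and rep: "representing_measure_on \<beta> k cubic_curve \<mu>"
    and sing: "\<not> pos_def (hankel (3 * k) (curve_moment \<beta>))"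
  shows "mat_rank (hankel (3 * k - 1) (curve_moment \<beta>)) = mat_rank (moment_matrix \<beta> k)"
    and "mat_rank (hankel (3 * k) (curve_moment \<beta>)) = mat_rank (moment_matrix \<beta> k)"
    and "atomic (mat_rank (moment_matrix \<beta> k)) \<mu>"
proof -
  define n where "n = 3 * k - 1"
  have n: "3 * k = Suc n" using k by (simp add: n_def)
  obtain f where f: "f \<noteq> 0" "degree f \<le> 3 * k - 1" "\<not> 0 < momL (curve_moment \<beta>) (f * f)"
    using sing unfolding n pos_def_hankel_iff by auto
  then have f0: "momL (curve_moment \<beta>) (f * f) = 0"
    using representing_measure_nonneg[OF rep k f(2)] by simp
  have "mat_rank (hankel (3 * k - 1) (curve_moment \<beta>)) = mat_rank (moment_matrix \<beta> k) \<and>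
    mat_rank (hankel (3 * k) (curve_moment \<beta>)) = mat_rank (moment_matrix \<beta> k) \<and>
    atomic (mat_rank (moment_matrix \<beta> k)) \<mu>"
  proof (rule representing_measure_null_poly[OF rep k f(1,2) f0])
    fix S w
    assume S: "finite S" "card S \<le> degree f" "\<And>s. s \<in> S \<Longrightarrow> 0 < w s" "atomic (card S) \<mu>"
      "\<And>i j. i + j \<le> 2 * k \<Longrightarrow> \<beta> i j = (\<Sum>s\<in>S. w s * s ^ (i + 3 * j))"
    have card: "card S \<le> 3 * k - 1" using S(2) f(2) by simp
    have M: "mat_rank (moment_matrix \<beta> k) = card S"
      by (rule mat_rank_moment_matrix_atoms[OF S(1,3) card S(5)])
    have g: "curve_moment \<beta> i = (\<Sum>s\<in>S. w s * s ^ i)" if "i \<le> 6 * k - 2" for i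
      using S(5)[OF mod_div_in_triangle[of i "2 * k"]] that k by (simp add: curve_moment_def)
    have "mat_rank (hankel m (curve_moment \<beta>)) = card S" if "3 * k - 1 \<le> m" "m \<le> 3 * k" for m
      by (rule mat_rank_hankel_atoms[OF S(1,3) _ g]) (use that card in auto)
    then show ?thesis unfolding M using S(4) by simp
  qed
  then show "mat_rank (hankel (3 * k - 1) (curve_moment \<beta>)) = mat_rank (moment_matrix \<beta> k)"
    "mat_rank (hankel (3 * k) (curve_moment \<beta>)) = mat_rank (moment_matrix \<beta> k)"
    "atomic (mat_rank (moment_matrix \<beta> k)) \<mu>" by blast+
qed

section \<open>The moment problem on the cubic\<close>

theorem corollary3p3:
  fixes k :: nat and \<beta> :: "nat \<Rightarrow> nat \<Rightarrow> real"
  assumes "k \<ge> 1"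
    and "pos_semidef (moment_matrix \<beta> k)"
    and "recursively_generated \<beta> k"
  shows "((\<exists>\<mu>. representing_measure_on \<beta> k cubic_curve \<mu>) \<longleftrightarrow>
      ((k \<ge> 3 \<longrightarrow> moment_column \<beta> k 0 1 = moment_column \<beta> k 3 0) \<and>
       (k = 2 \<longrightarrow> \<beta> 0 1 = \<beta> 3 0 \<and> \<beta> 1 1 = \<beta> 4 0 \<and> \<beta> 0 2 = \<beta> 3 1)) \<and>
      (pos_def (hankel_mat (beta_tilde \<beta> k)) \<or>
       pos_semidef (hankel_mat (beta_tilde \<beta> k)) \<and>
       mat_rank (hankel_mat (beta_hat \<beta> k)) = mat_rank (hankel_mat (beta_tilde \<beta> k)) \<and>
       mat_rank (hankel_mat (beta_tilde \<beta> k)) = mat_rank (moment_matrix \<beta> k)))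
    \<and> ((\<exists>\<mu>. representing_measure_on \<beta> k cubic_curve \<mu>) \<longrightarrow>
        (invertible_mat (hankel_mat (beta_tilde \<beta> k)) \<longrightarrow>
          (\<exists>\<mu>. representing_measure_on \<beta> k cubic_curve \<mu> \<and> atomic (3 * k) \<mu>)) \<and>
        (\<not> invertible_mat (hankel_mat (beta_tilde \<beta> k)) \<longrightarrow>
          (\<forall>\<mu>. representing_measure_on \<beta> k cubic_curve \<mu> \<longrightarrow>
             atomic (mat_rank (moment_matrix \<beta> k)) \<mu>)))"
    (is "(?rep \<longleftrightarrow> (?cols \<and> ?two) \<and> (?pd \<or> ?psd \<and> ?rank1 \<and> ?rank2)) \<and> (?rep \<longrightarrow> ?inv \<and> ?sing)")
proof -
  note k = assms(1)
  define n where "n = 3 * k - 1"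
  have n: "3 * k = Suc n" using k by (simp add: n_def)
  note hat = hankel_mat_beta_hat[OF k, of \<beta>] and tilde = hankel_mat_beta_tilde[OF k, of \<beta>]
  have pd_atomic: "\<exists>\<mu>. representing_measure_on \<beta> k cubic_curve \<mu> \<and> atomic (3 * k) \<mu>"
    if cons: "\<And>i j. i + j \<le> 2 * k \<Longrightarrow> \<beta> i j = curve_moment \<beta> (i + 3 * j)"
      and pd: "pos_def (hankel (3 * k) (curve_moment \<beta>))"
  proof (rule atoms_of_pos_def[OF k cons assms(2) pd])
    fix S w
    assume S: "finite S" "card S = 3 * k" "\<And>s. s \<in> S \<Longrightarrow> 0 < w s"
      "\<And>i j. i + j \<le> 2 * k \<Longrightarrow> \<beta> i j = (\<Sum>s\<in>S. w s * s ^ (i + 3 * j))"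
    show ?thesis using representing_measure_of_atoms[OF S(1,3,4)] S(2) by simp
  qed
  have psd: "pos_semidef (hankel (3 * k) (curve_moment \<beta>))"
    if "representing_measure_on \<beta> k cubic_curve \<mu>" for \<mu>
    using representing_measure_nonneg[OF that k] unfolding n pos_semidef_hankel_iff by simp
  have necessary: "(?cols \<and> ?two) \<and> (?pd \<or> ?psd \<and> ?rank1 \<and> ?rank2)" if rep: ?rep
  proof -
    obtain \<mu> where \<mu>: "representing_measure_on \<beta> k cubic_curve \<mu>" using rep by blast
    note cons = representing_measure_moments(1)[OF \<mu> k]
    have ?cols
    proof (intro impI eq_vecI)
      fix r assume k3: "k \<ge> 3" and "r < dim_vec (moment_column \<beta> k 3 0)"
      then have r: "r < length (monomials k)" by (simp add: moment_column_def)
      have "fst (monomials k ! r) + snd (monomials k ! r) \<le> k"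
        using nth_mem[OF r] unfolding set_monomials by auto
      then show "moment_column \<beta> k 0 1 $ r = moment_column \<beta> k 3 0 $ r"
        using k3 unfolding moment_column_nth[OF r] moment_entry_def
        by (simp add: cons algebra_simps)
    qed (simp add: moment_column_def)
    moreover have ?two
      using cons[of 0 1] cons[of 3 0] cons[of 1 1] cons[of 4 0] cons[of 0 2] cons[of 3 1] by simp
    moreover have "?pd \<or> ?psd \<and> ?rank1 \<and> ?rank2"
      \<comment> \<open>Either (a) holds or it fails, and failure alone already yields both rank
        equalities of (b).\<close>
      using psd[OF \<mu>] representing_measure_singular(1,2)[OF k \<mu>] unfolding hat tilde by metis
    ultimately show ?thesis by blast
  qed
  have sufficient: ?rep if C: "?cols \<and> ?two" and D: "?pd \<or> ?psd \<and> ?rank1 \<and> ?rank2"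
  proof -
    have cons: "\<beta> i j = curve_moment \<beta> (i + 3 * j)" if "i + j \<le> 2 * k" for i j
      by (rule moments_on_curve[OF k assms(3) _ _ that]) (use C in blast)+
    show ?rep
    proof (cases ?pd)
      case True
      then show ?thesis using pd_atomic[OF cons] unfolding tilde by blast
    next
      case False
      then have D': "pos_semidef (hankel (3 * k) (curve_moment \<beta>))"
        "mat_rank (hankel (3 * k - 1) (curve_moment \<beta>)) = mat_rank (hankel (3 * k) (curve_moment \<beta>))"
        "mat_rank (hankel (3 * k) (curve_moment \<beta>)) = mat_rank (moment_matrix \<beta> k)"
        using D unfolding hat tilde by blast+
      show ?thesis
      proof (rule atoms_of_flat[OF k cons D'])
        fix S w
        assume S: "finite S" "\<And>s. s \<in> S \<Longrightarrow> 0 < w s"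
          "\<And>i j. i + j \<le> 2 * k \<Longrightarrow> \<beta> i j = (\<Sum>s\<in>S. w s * s ^ (i + 3 * j))"
        show ?rep using representing_measure_of_atoms[OF S] by blast
      qed
    qed
  qed
  have inv: ?inv if rep: ?rep
  proof
    obtain \<mu> where \<mu>: "representing_measure_on \<beta> k cubic_curve \<mu>" using rep by blast
    assume "invertible_mat (hankel_mat (beta_tilde \<beta> k))"
    \<comment> \<open>The measure makes the Hankel matrix semidefinite; invertibility upgrades this
      to definiteness, and the construction for (a) replaces the given measure by one with 3k
      atoms.\<close>
    then have "pos_def (hankel (3 * k) (curve_moment \<beta>))"
      using representing_measure_nonneg[OF \<mu> k] unfolding tilde n
      by (intro pos_def_hankel_if_invertible) simp_all
    then show "\<exists>\<mu>. representing_measure_on \<beta> k cubic_curve \<mu> \<and> atomic (3 * k) \<mu>"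
      by (intro pd_atomic representing_measure_moments(1)[OF \<mu> k])
  qed
  have sing: ?sing
  proof (intro impI allI)
    fix \<mu> assume "\<not> invertible_mat (hankel_mat (beta_tilde \<beta> k))"
      and \<mu>: "representing_measure_on \<beta> k cubic_curve \<mu>"
    then have "\<not> pos_def (hankel (3 * k) (curve_moment \<beta>))"
      using invertible_if_pos_def unfolding tilde by blast
    then show "atomic (mat_rank (moment_matrix \<beta> k)) \<mu>"
      by (rule representing_measure_singular(3)[OF k \<mu>])
  qed
  show ?thesis
  proof (intro conjI)
    show "?rep \<longleftrightarrow> (?cols \<and> ?two) \<and> (?pd \<or> ?psd \<and> ?rank1 \<and> ?rank2)"
    proof
      assume "(?cols \<and> ?two) \<and> (?pd \<or> ?psd \<and> ?rank1 \<and> ?rank2)"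
      then show ?rep by (elim conjE[of "?cols \<and> ?two"]) (rule sufficient)
    qed (rule necessary)
    show "?rep \<longrightarrow> ?inv \<and> ?sing"
    proof
      assume ?rep
      show "?inv \<and> ?sing" by (rule conjI[OF inv[OF \<open>?rep\<close>] sing])
    qed
  qed
qed

end
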